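(* Let $M$ be a locally compact, but not compact, Polish space with a positive, locally finite Borel measure $\mu$ of full topological support, and let $\{U_t:t\ge 0\}$ be a strongly continuous semigroup of bounded, positivity preserving linear operators on $L^2(M,\mu)$ with adjoint semigroup $\{U_t^*:t\ge 0\}$, both given for $t>0$ by a real-valued measurable kernel $u_t(x,y)$. Fix $t_0>0$ and assume: every $U_t$, $t>0$, is compact on $L^2(M,\mu)$; $U_{t_0}$ is positivity improving; both semigroups have the strong Feller property; $U_{t_0},U_{t_0}^*:L^2(M,\mu)\to L^\infty(M,\mu)$ are bounded; and for every $t\ge t_0$ and $\epsilon>0$ there is a compact set $K\subset M$ with $U_t\mathbf 1_M(x)\le\epsilon$ and $U_t^*\mathbf 1_M(x)\le\epsilon$ for every $x\in M\setminus K$. Let $\lambda_0,\mathcal N,m,m^*$ be as defined in the context. Assume that both semigroups $\{U_t\}$ and $\{U_t^*\}$ are progressively ground state dominated (pGSD) and that there exists $t_2>0$ such that $$\sup_{t\ge t_2}\Big(e^{\lambda_0t}\sup_{x\in M}\big(U_t\mathbf 1_M(x)+U_t^*\mathbf 1_M(x)\big)\Big)<\infty.$$ Then $m$ and $m^*$ are the unique quasi-stationary probability measures of $\{U_t\}$ and $\{U_t^*\}$, respectively, with $m(M\setminus\mathcal N)\cdot m^*(M\setminus\mathcal N)>0$; that is, $m,m^*$ are quasi-stationary with this property, and if $\bar m$, $\bar m^*$ are quasi-stationary probability measures of $\{U_t\}$, $\{U_t^*\}$, respectively, with $\bar m(M\setminus\mathcal N)\cdot\bar m^*(M\setminus\mathcal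 N)>0$, then $\bar m=m$ and $\bar m^*=m^*$.
   Context: For a measure $\sigma$ write $\sigma(g)=\int g\,d\sigma$; $\mathbf 1_M$ is the constant function $1$. Kernels: $U_tf(x)=\int u_t(x,y)f(y)\,\mu(dy)$ and $U_t^*g(y)=\int u_t(x,y)g(x)\,\mu(dx)$, $t>0$; these formulas also define $U_t,U_t^*$ on $L^\infty(M,\mu)$. Positivity preserving: $f\ge0$ a.e. implies $U_tf\ge 0$ a.e. Positivity improving: $f\ge 0$, $f\not\equiv 0$ in $L^2$ implies $U_{t_0}f>0$ $\mu$-a.e. Strong Feller property: for every $t>0$ and $f\in L^\infty(M,\mu)$ one has $U_tf,U_t^*f\in C_b(M)$; $U_tf$, $U_t^*f$ are understood as these continuous functions. Ground states: with $A$ the generator of $\{U_t\}$ and $A^*$ that of $\{U_t^*\}$, $\lambda_0:=\inf\mathrm{Re}(\mathrm{Spec}(-A))=\inf\mathrm{Re}(\mathrm{Spec}(-A^* ))$ is a joint isolated simple eigenvalue of $-A$ and $-A^*$, with $L^2$-normalized, $\mu$-a.e. strictly positive eigenfunctions $\phi_0$ (of $-A$) and $\psi_0$ (of $-A^*$), so $U_t\phi_0=e^{-\lambda_0t}\phi_0$, $U_t^*\psi_0=e^{-\lambda_0t}\psi_0$; they have continuous bounded versions, which are used. Set $\mathcal N:=\{\phi_0=0\}\cup\{\psi_0=0\}$ (a closed $\mu$-null set). Exhausting family: a family $\{K_t:t\ge t_1\}$ of compact subsets of $M$ with $K_t\subset K_s$ for $t_1\le t<s$, $\bigcup_{t\ge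 t_1}K_t=M$, and such that every compact $K\subset M$ is contained in some $K_t$. pGSD: $\{U_t\}$ is pGSD if there exist $C,t_1>0$ and an exhausting family $\{K_t:t\ge t_1\}$ with $\mathbf 1_{K_t}(x)U_t\mathbf 1_M(x)\le Ce^{-\lambda_0t}\phi_0(x)$ for all $t\ge t_1$, $x\in M$; for $\{U_t^*\}$ replace $U_t,\phi_0$ by $U_t^*,\psi_0$. If both semigroups are pGSD then $\phi_0,\psi_0\in L^1(M,\mu)$, and one defines the probability measures $m(E)=\int_E\psi_0\,d\mu/\int_M\psi_0\,d\mu$ and $m^*(E)=\int_E\phi_0\,d\mu/\int_M\phi_0\,d\mu$. Quasi-stationary measure: a probability measure $\bar m$ on the Borel sets of $M$ is quasi-stationary for $\{U_t\}$ if for all $t>0$ and $f\in L^\infty(M,\mu)$ we have $\bar m(U_t\mathbf 1_M)>0$ and $\bar m(U_tf)/\bar m(U_t\mathbf 1_M)=\bar m(f)$; analogously for $\{U_t^*\}$. *)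

theory Defs
  imports "HOL-Analysis.Analysis" "HOL-Probability.Probability_Measure"
begin

text \<open>Conventions. An element of \<open>L\<^sup>2(M, \<mu>)\<close> is a square-integrable complex-valued function, and all
  assertions about it are made \<open>\<mu>\<close>-almost everywhere; the scalars are complex because spectra are
  considered. Elements of \<open>L\<^sup>\<infinity>(M, \<mu>)\<close> are taken real-valued: the kernels are real, so the kernel
  operators act separately on real and imaginary parts.\<close>

definition locally_finite_measure :: "'a::topological_space measure \<Rightarrow> bool" where
  "locally_finite_measure \<mu> \<longleftrightarrow> (\<forall>x. \<exists>V. open V \<and> x \<in> V \<and> emeasure \<mu> V < \<infinity>)"

definition full_support :: "'a::topological_space measure \<Rightarrow> bool" where
  "full_support \<mu> \<longleftrightarrow> (\<forall>V. open V \<and> V \<noteq> {} \<longrightarrow> emeasure \<mu> V > 0)"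

definition L2 :: "'a measure \<Rightarrow> ('a \<Rightarrow> complex) set" where
  "L2 \<mu> = {f \<in> borel_measurable \<mu>. integrable \<mu> (\<lambda>x. (cmod (f x))\<^sup>2)}"

definition l2norm :: "'a measure \<Rightarrow> ('a \<Rightarrow> complex) \<Rightarrow> real" where
  "l2norm \<mu> f = sqrt (LINT x|\<mu>. (cmod (f x))\<^sup>2)"

definition l2inner :: "'a measure \<Rightarrow> ('a \<Rightarrow> complex) \<Rightarrow> ('a \<Rightarrow> complex) \<Rightarrow> complex" where
  "l2inner \<mu> f g = (LINT x|\<mu>. f x * cnj (g x))"

definition Linf :: "'a measure \<Rightarrow> ('a \<Rightarrow> real) set" where
  "Linf \<mu> = {f \<in> borel_measurable \<mu>. \<exists>C. AE x in \<mu>. \<bar>f x\<bar> \<le> C}"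

text \<open>The norm bound together with linearity makes such a map compatible with equality
  \<open>\<mu>\<close>-almost everywhere, so it descends to equivalence classes.\<close>

definition bounded_l2_operator :: "'a measure \<Rightarrow> (('a \<Rightarrow> complex) \<Rightarrow> 'a \<Rightarrow> complex) \<Rightarrow> bool" where
  "bounded_l2_operator \<mu> T \<longleftrightarrow>
     (\<forall>f\<in>L2 \<mu>. T f \<in> L2 \<mu>) \<and>
     (\<forall>f\<in>L2 \<mu>. \<forall>g\<in>L2 \<mu>. \<forall>a b. AE x in \<mu>. T (\<lambda>y. a * f y + b * g y) x = a * T f x + b * T g x) \<and>
     (\<exists>C. \<forall>f\<in>L2 \<mu>. l2norm \<mu> (T f) \<le> C * l2norm \<mu> f)"

definition l2_adjoint ::
  "'a measure \<Rightarrow> (('a \<Rightarrow> complex) \<Rightarrow> 'a \<Rightarrow> complex) \<Rightarrow> (('a \<Rightarrow> complex) \<Rightarrow> 'a \<Rightarrow> complex) \<Rightarrow> bool" where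
  "l2_adjoint \<mu> T S \<longleftrightarrow> bounded_l2_operator \<mu> S \<and>
     (\<forall>f\<in>L2 \<mu>. \<forall>g\<in>L2 \<mu>. l2inner \<mu> (T f) g = l2inner \<mu> f (S g))"

definition compact_l2_operator :: "'a measure \<Rightarrow> (('a \<Rightarrow> complex) \<Rightarrow> 'a \<Rightarrow> complex) \<Rightarrow> bool" where
  "compact_l2_operator \<mu> T \<longleftrightarrow>
     (\<forall>f :: nat \<Rightarrow> 'a \<Rightarrow> complex. (\<forall>n. f n \<in> L2 \<mu> \<and> l2norm \<mu> (f n) \<le> 1) \<longrightarrow>
        (\<exists>r. \<exists>g\<in>L2 \<mu>. strict_mono r \<and> (\<lambda>n. l2norm \<mu> (\<lambda>x. T (f (r n)) x - g x)) \<longlonglongrightarrow> 0))"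

definition positivity_preserving :: "'a measure \<Rightarrow> (('a \<Rightarrow> complex) \<Rightarrow> 'a \<Rightarrow> complex) \<Rightarrow> bool" where
  "positivity_preserving \<mu> T \<longleftrightarrow>
     (\<forall>f\<in>L2 \<mu>. (AE x in \<mu>. f x \<in> \<real>\<^sub>\<ge>\<^sub>0) \<longrightarrow> (AE x in \<mu>. T f x \<in> \<real>\<^sub>\<ge>\<^sub>0))"

definition positivity_improving :: "'a measure \<Rightarrow> (('a \<Rightarrow> complex) \<Rightarrow> 'a \<Rightarrow> complex) \<Rightarrow> bool" where
  "positivity_improving \<mu> T \<longleftrightarrow>
     (\<forall>f\<in>L2 \<mu>. (AE x in \<mu>. f x \<in> \<real>\<^sub>\<ge>\<^sub>0) \<and> \<not> (AE x in \<mu>. f x = 0) \<longrightarrow>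
        (AE x in \<mu>. T f x \<in> \<real>\<^sub>\<ge>\<^sub>0 - {0}))"

definition bounded_L2_to_Linf :: "'a measure \<Rightarrow> (('a \<Rightarrow> complex) \<Rightarrow> 'a \<Rightarrow> complex) \<Rightarrow> bool" where
  "bounded_L2_to_Linf \<mu> T \<longleftrightarrow>
     (\<exists>C. \<forall>f\<in>L2 \<mu>. AE x in \<mu>. cmod (T f x) \<le> C * l2norm \<mu> f)"

definition strongly_continuous_semigroup ::
  "'a measure \<Rightarrow> (real \<Rightarrow> ('a \<Rightarrow> complex) \<Rightarrow> 'a \<Rightarrow> complex) \<Rightarrow> bool" where
  "strongly_continuous_semigroup \<mu> U \<longleftrightarrow>
     (\<forall>t\<ge>0. bounded_l2_operator \<mu> (U t)) \<and>
     (\<forall>f\<in>L2 \<mu>. AE x in \<mu>. U 0 f x = f x) \<and>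
     (\<forall>s\<ge>0. \<forall>t\<ge>0. \<forall>f\<in>L2 \<mu>. AE x in \<mu>. U (s + t) f x = U s (U t f) x) \<and>
     (\<forall>f\<in>L2 \<mu>. ((\<lambda>t. l2norm \<mu> (\<lambda>x. U t f x - f x)) \<longlongrightarrow> 0) (at_right 0))"

text \<open>Unbounded operators are given by their graphs: \<open>A f g\<close> means that \<open>f\<close> is in the domain of \<open>A\<close>
  and \<open>A f = g\<close>.\<close>

definition generator ::
  "'a measure \<Rightarrow> (real \<Rightarrow> ('a \<Rightarrow> complex) \<Rightarrow> 'a \<Rightarrow> complex) \<Rightarrow> ('a \<Rightarrow> complex) \<Rightarrow> ('a \<Rightarrow> complex) \<Rightarrow> bool" where
  "generator \<mu> U f g \<longleftrightarrow> f \<in> L2 \<mu> \<and> g \<in> L2 \<mu> \<and>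
     ((\<lambda>t. l2norm \<mu> (\<lambda>x. (U t f x - f x) / complex_of_real t - g x)) \<longlongrightarrow> 0) (at_right 0)"

definition neg_generator ::
  "'a measure \<Rightarrow> (real \<Rightarrow> ('a \<Rightarrow> complex) \<Rightarrow> 'a \<Rightarrow> complex) \<Rightarrow> ('a \<Rightarrow> complex) \<Rightarrow> ('a \<Rightarrow> complex) \<Rightarrow> bool" where
  "neg_generator \<mu> U f g \<longleftrightarrow> generator \<mu> U f (\<lambda>x. - g x)"

text \<open>\<open>z\<close> is in the resolvent set of \<open>B\<close> iff \<open>z - B\<close>, defined on the domain of \<open>B\<close>, has a bounded
  everywhere defined two-sided inverse \<open>R\<close>.\<close>

definition l2_resolvent_set ::
  "'a measure \<Rightarrow> (('a \<Rightarrow> complex) \<Rightarrow> ('a \<Rightarrow> complex) \<Rightarrow> bool) \<Rightarrow> complex set" where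
  "l2_resolvent_set \<mu> B = {z. \<exists>R. bounded_l2_operator \<mu> R \<and>
     (\<forall>h\<in>L2 \<mu>. \<exists>g. B (R h) g \<and> (AE x in \<mu>. z * R h x - g x = h x)) \<and>
     (\<forall>f g. B f g \<longrightarrow> (AE x in \<mu>. R (\<lambda>y. z * f y - g y) x = f x))}"

definition l2_spectrum ::
  "'a measure \<Rightarrow> (('a \<Rightarrow> complex) \<Rightarrow> ('a \<Rightarrow> complex) \<Rightarrow> bool) \<Rightarrow> complex set" where
  "l2_spectrum \<mu> B = - l2_resolvent_set \<mu> B"

definition spectral_bottom ::
  "'a measure \<Rightarrow> (real \<Rightarrow> ('a \<Rightarrow> complex) \<Rightarrow> 'a \<Rightarrow> complex) \<Rightarrow> real" where
  "spectral_bottom \<mu> U = Inf (Re ` l2_spectrum \<mu> (neg_generator \<mu> U))"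

text \<open>With \<open>l = spectral_bottom \<mu> U\<close>, \<open>\<phi>\<close> is a normalized positive eigenfunction of \<open>-A\<close> at the
  bottom of its spectrum. Continuity and full support make it determined by its class.\<close>

definition ground_state ::
  "'a::topological_space measure \<Rightarrow> (real \<Rightarrow> ('a \<Rightarrow> complex) \<Rightarrow> 'a \<Rightarrow> complex) \<Rightarrow> real \<Rightarrow> ('a \<Rightarrow> real) \<Rightarrow> bool" where
  "ground_state \<mu> U l \<phi> \<longleftrightarrow>
     neg_generator \<mu> U (\<lambda>x. complex_of_real (\<phi> x)) (\<lambda>x. complex_of_real l * complex_of_real (\<phi> x)) \<and>
     l2norm \<mu> (\<lambda>x. complex_of_real (\<phi> x)) = 1 \<and>
     (AE x in \<mu>. \<phi> x > 0) \<and>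
     continuous_on UNIV \<phi> \<and> bounded (range \<phi>)"

definition kernel_op :: "'a measure \<Rightarrow> ('a \<Rightarrow> 'a \<Rightarrow> real) \<Rightarrow> ('a \<Rightarrow> real) \<Rightarrow> 'a \<Rightarrow> real" where
  "kernel_op \<mu> k f x = (LINT y|\<mu>. k x y * f y)"

definition has_kernel ::
  "'a measure \<Rightarrow> (('a \<Rightarrow> complex) \<Rightarrow> 'a \<Rightarrow> complex) \<Rightarrow> ('a \<Rightarrow> 'a \<Rightarrow> real) \<Rightarrow> bool" where
  "has_kernel \<mu> T k \<longleftrightarrow> case_prod k \<in> borel_measurable (\<mu> \<Otimes>\<^sub>M \<mu>) \<and>
     (\<forall>f\<in>L2 \<mu>. AE x in \<mu>. integrable \<mu> (\<lambda>y. complex_of_real (k x y) * f y) \<and>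
        T f x = (LINT y|\<mu>. complex_of_real (k x y) * f y))"

definition transpose_kernel :: "(real \<Rightarrow> 'a \<Rightarrow> 'a \<Rightarrow> real) \<Rightarrow> real \<Rightarrow> 'a \<Rightarrow> 'a \<Rightarrow> real" where
  "transpose_kernel u t x y = u t y x"

definition strong_Feller :: "'a::topological_space measure \<Rightarrow> (real \<Rightarrow> 'a \<Rightarrow> 'a \<Rightarrow> real) \<Rightarrow> bool" where
  "strong_Feller \<mu> u \<longleftrightarrow> (\<forall>t>0. \<forall>f\<in>Linf \<mu>.
     (AE x in \<mu>. integrable \<mu> (\<lambda>y. u t x y * f y)) \<and>
     (\<exists>g. continuous_on UNIV g \<and> bounded (range g) \<and> (AE x in \<mu>. kernel_op \<mu> (u t) f x = g x)))"

text \<open>The action of the kernel \<open>u t\<close> on \<open>L\<^sup>\<infinity>\<close>, realised by the continuous representative. The latter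
  exists by the strong Feller property, is unique since \<open>\<mu>\<close> has full support, and coincides with
  \<open>kernel_op\<close> everywhere if that function is itself continuous.\<close>

definition Feller_op ::
  "'a::topological_space measure \<Rightarrow> (real \<Rightarrow> 'a \<Rightarrow> 'a \<Rightarrow> real) \<Rightarrow> real \<Rightarrow> ('a \<Rightarrow> real) \<Rightarrow> 'a \<Rightarrow> real" where
  "Feller_op \<mu> u t f = (THE g. continuous_on UNIV g \<and> (AE x in \<mu>. kernel_op \<mu> (u t) f x = g x))"

definition exhausting_family :: "real \<Rightarrow> (real \<Rightarrow> 'a::topological_space set) \<Rightarrow> bool" where
  "exhausting_family t1 K \<longleftrightarrow>
     (\<forall>t\<ge>t1. compact (K t)) \<and>
     (\<forall>t s. t1 \<le> t \<and> t < s \<longrightarrow> K t \<subseteq> K s) \<and>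
     (\<Union>t\<in>{t1..}. K t) = UNIV \<and>
     (\<forall>C. compact C \<longrightarrow> (\<exists>t\<ge>t1. C \<subseteq> K t))"

definition pGSD ::
  "'a::topological_space measure \<Rightarrow> (real \<Rightarrow> 'a \<Rightarrow> 'a \<Rightarrow> real) \<Rightarrow> real \<Rightarrow> ('a \<Rightarrow> real) \<Rightarrow> bool" where
  "pGSD \<mu> u l \<phi> \<longleftrightarrow> (\<exists>C>0. \<exists>t1>0. \<exists>K. exhausting_family t1 K \<and>
     (\<forall>t\<ge>t1. \<forall>x. indicator (K t) x * Feller_op \<mu> u t (\<lambda>_. 1) x \<le> C * exp (- l * t) * \<phi> x))"

definition normalized_measure :: "'a measure \<Rightarrow> ('a \<Rightarrow> real) \<Rightarrow> 'a measure" where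
  "normalized_measure \<mu> \<psi> = density \<mu> (\<lambda>x. ennreal (\<psi> x / (LINT y|\<mu>. \<psi> y)))"

text \<open>Since \<open>Feller_op \<mu> u t f\<close> depends only on the \<open>\<mu>\<close>-class of \<open>f\<close>, the condition (required for
  every representative \<open>f\<close>) forces a quasi-stationary measure to be absolutely continuous with
  respect to \<open>\<mu>\<close>.\<close>

definition quasi_stationary ::
  "'a::topological_space measure \<Rightarrow> (real \<Rightarrow> 'a \<Rightarrow> 'a \<Rightarrow> real) \<Rightarrow> 'a measure \<Rightarrow> bool" where
  "quasi_stationary \<mu> u \<nu> \<longleftrightarrow> sets \<nu> = sets borel \<and> prob_space \<nu> \<and>
     (\<forall>t>0. \<forall>f\<in>Linf \<mu>.
        (LINT x|\<nu>. Feller_op \<mu> u t (\<lambda>_. 1) x) > 0 \<and>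
        (LINT x|\<nu>. Feller_op \<mu> u t f x) / (LINT x|\<nu>. Feller_op \<mu> u t (\<lambda>_. 1) x) = (LINT x|\<nu>. f x))"

end

theory Submission
  imports Defs "HOL-Real_Asymp.Real_Asymp"
begin

text \<open>
  Write \<open>P\<^sub>t\<close> and \<open>Q\<^sub>t\<close> for the operators with kernels \<open>u t\<close> and its transpose, acting on real
  functions; they are positive, adjoint to each other, and form semigroups on \<open>L\<^sup>2\<close>. Let \<open>l\<close> be the
  bottom of the spectrum, \<open>\<phi>\<close> and \<open>\<psi>\<close> the ground states of \<open>P\<close> and \<open>Q\<close>.

  \<^emph>\<open>Ground states are eigenfunctions of the semigroups.\<close> They are given as eigenvectors of the
  generators. The operators \<open>P\<^sub>t\<close> are uniformly bounded for small \<open>t\<close>: otherwise suitable functions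
  \<open>g\<^sub>n \<ge> 0\<close>, small in \<open>L\<^sup>2\<close> but with large images under \<open>P\<close> at times tending to \<open>0\<close>, have a common
  majorant in \<open>L\<^sup>2\<close>, at which positivity contradicts strong continuity (\<open>small_time_bound\<close>). By
  duality the same bound holds for \<open>Q\<close>, and cutting \<open>[0, t]\<close> into short pieces yields
  \<open>P\<^sub>t \<phi> = exp (- l t) \<phi>\<close> and \<open>Q\<^sub>t \<psi> = exp (- l t) \<psi>\<close> (\<open>eigenvector_of_generator\<close>).

  \<^emph>\<open>Ground states are integrable.\<close> For \<open>A\<close> of finite measure,
  \<open>\<integral>\<^sub>A \<phi> = exp (l t) \<integral> \<phi> \<cdot> Q\<^sub>t 1\<^sub>A\<close>. On the exhausting set \<open>K\<^sub>t\<close>, domination of \<open>Q\<^sub>t 1\<close> by the ground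
  state bounds the right-hand side by \<open>C \<integral> \<phi> \<psi>\<close>; off \<open>K\<^sub>t\<close>, the function \<open>\<phi>\<close> is small in \<open>L\<^sup>2\<close> for
  large \<open>t\<close>, while \<open>exp (l t) Q\<^sub>t 1\<^sub>A\<close> stays bounded in \<open>L\<^sup>2\<close> by the uniform bounds on
  \<open>exp (l t) P\<^sub>t 1\<close> and \<open>exp (l t) Q\<^sub>t 1\<close>. So \<open>\<integral>\<^sub>A \<phi> \<le> C \<integral> \<phi> \<psi>\<close> for every such \<open>A\<close>
  (\<open>\<phi>_integrable\<close>).

  \<^emph>\<open>Existence.\<close> Duality now extends to bounded functions, \<open>\<integral> \<psi> P\<^sub>t f = exp (- l t) \<integral> \<psi> f\<close>, and this
  says that \<open>\<psi> \<mu>\<close>, normalized, is quasi-stationary.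

  \<^emph>\<open>Uniqueness.\<close> A quasi-stationary measure \<open>\<nu>\<close> gives no mass to a \<open>\<mu>\<close>-null set, because the
  indicator of such a set is the zero element of \<open>L\<^sup>\<infinity>\<close>; so \<open>\<nu> = \<rho> \<mu>\<close>. Testing with \<open>f = \<phi>\<close>, where
  \<open>\<nu>(\<phi>) > 0\<close>, gives \<open>\<nu>(P\<^sub>t 1) = exp (- l t)\<close>, so that \<open>\<rho>\<close> is formally an eigenfunction of \<open>Q\<^sub>t\<close> for
  the same eigenvalue as \<open>\<psi>\<close>. The smoothing \<open>L\<^sup>2 \<rightarrow> L\<^sup>\<infinity>\<close> of \<open>P\<close> at the time \<open>t0\<close> dualizes to
  \<open>\<rho> \<in> L\<^sup>2\<close>, and there the eigenspace is one-dimensional since the semigroup improves positivity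
  (\<open>\<psi>_simple\<close>). Hence \<open>\<rho>\<close> is a multiple of \<open>\<psi>\<close>.

  All of this is symmetric in the two semigroups, so one side is proved and the other follows by
  exchanging the roles (\<open>swap\<close>).
\<close>

section \<open>Real square-integrable functions\<close>

definition sq_integrable :: "'a measure \<Rightarrow> ('a \<Rightarrow> real) \<Rightarrow> bool" where
  "sq_integrable M f \<longleftrightarrow> f \<in> borel_measurable M \<and> integrable M (\<lambda>x. (f x)\<^sup>2)"

definition sq_norm :: "'a measure \<Rightarrow> ('a \<Rightarrow> real) \<Rightarrow> real" where
  "sq_norm M f = sqrt (LINT x|M. (f x)\<^sup>2)"

lemma sq_norm_nonneg: "0 \<le> sq_norm M f"
  by (simp add: sq_norm_def)

lemma sq_norm_power2: "(sq_norm M f)\<^sup>2 = (LINT x|M. (f x)\<^sup>2)"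
  by (simp add: sq_norm_def)

lemma sq_integrable_dominated:
  assumes "sq_integrable M f" and [measurable]: "g \<in> borel_measurable M"
    and "AE x in M. \<bar>g x\<bar> \<le> \<bar>f x\<bar>"
  shows "sq_integrable M g" and "sq_norm M g \<le> sq_norm M f"
proof -
  have le: "AE x in M. (g x)\<^sup>2 \<le> (f x)\<^sup>2"
    using assms(3) by eventually_elim (simp add: abs_le_square_iff)
  have f: "integrable M (\<lambda>x. (f x)\<^sup>2)"
    using assms(1) by (simp add: sq_integrable_def)
  have g: "integrable M (\<lambda>x. (g x)\<^sup>2)"
    by (rule Bochner_Integration.integrable_bound[OF f]) (use le in auto)
  then show "sq_integrable M g"
    by (simp add: sq_integrable_def)
  show "sq_norm M g \<le> sq_norm M f"
    unfolding sq_norm_def by (intro real_sqrt_le_mono integral_mono_AE g f le)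
qed

lemma sq_integrable_scale:
  "sq_integrable M f \<Longrightarrow> sq_integrable M (\<lambda>x. c * f x)"
  by (auto simp: sq_integrable_def power_mult_distrib)

lemma sq_norm_scale: "sq_norm M (\<lambda>x. c * f x) = \<bar>c\<bar> * sq_norm M f"
  by (simp add: sq_norm_def power_mult_distrib real_sqrt_mult)

lemma sq_integrable_mult:
  assumes "sq_integrable M f" "sq_integrable M g"
  shows "integrable M (\<lambda>x. f x * g x)"
proof -
  have [measurable]: "f \<in> borel_measurable M" "g \<in> borel_measurable M"
    using assms by (auto simp: sq_integrable_def)
  have "integrable M (\<lambda>x. (f x)\<^sup>2 + (g x)\<^sup>2)"
    using assms by (auto simp: sq_integrable_def)
  then show ?thesis
  proof (rule Bochner_Integration.integrable_bound)
    have "norm (f x * g x) \<le> norm ((f x)\<^sup>2 + (g x)\<^sup>2)" for x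
  proof -
    have "0 \<le> (\<bar>f x\<bar> - \<bar>g x\<bar>)\<^sup>2" "0 \<le> \<bar>f x\<bar> * \<bar>g x\<bar>" by simp_all
    then have "\<bar>f x\<bar> * \<bar>g x\<bar> \<le> (f x)\<^sup>2 + (g x)\<^sup>2"
      unfolding power2_diff power2_abs by linarith
    then show ?thesis by (simp add: abs_mult)
  qed
    then show "AE x in M. norm (f x * g x) \<le> norm ((f x)\<^sup>2 + (g x)\<^sup>2)" by simp
  qed simp
qed

lemma sq_integrable_add:
  assumes "sq_integrable M f" "sq_integrable M g"
  shows "sq_integrable M (\<lambda>x. f x + g x)"
  using assms sq_integrable_mult[OF assms]
  by (auto simp: sq_integrable_def power2_sum mult.assoc)

lemma sq_integrable_diff:
  assumes "sq_integrable M f" "sq_integrable M g"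
  shows "sq_integrable M (\<lambda>x. f x - g x)"
  using sq_integrable_add[OF assms(1) sq_integrable_scale[OF assms(2), of "-1"]] by simp

lemma sq_integrable_abs: "sq_integrable M f \<Longrightarrow> sq_integrable M (\<lambda>x. \<bar>f x\<bar>)"
  by (auto simp: sq_integrable_def)

lemma sq_norm_abs: "sq_norm M (\<lambda>x. \<bar>f x\<bar>) = sq_norm M f"
  by (simp add: sq_norm_def)

lemma sq_norm_cong_AE:
  assumes "f \<in> borel_measurable M" "g \<in> borel_measurable M" "AE x in M. f x = g x"
  shows "sq_norm M f = sq_norm M g"
  unfolding sq_norm_def
  by (rule arg_cong[where f=sqrt], rule integral_cong_AE) (use assms in auto)

lemma sq_norm_eq_0:
  assumes "sq_integrable M f" "sq_norm M f = 0"
  shows "AE x in M. f x = 0"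
proof -
  have "AE x in M. (f x)\<^sup>2 = 0"
    using assms integral_nonneg_eq_0_iff_AE[of M "\<lambda>x. (f x)\<^sup>2"]
    by (auto simp: sq_integrable_def sq_norm_def)
  then show ?thesis by simp
qed

lemma sq_Cauchy_Schwarz:
  assumes "sq_integrable M f" "sq_integrable M g"
  shows "\<bar>LINT x|M. f x * g x\<bar> \<le> sq_norm M f * sq_norm M g"
proof -
  let ?a = "LINT x|M. (f x)\<^sup>2" and ?b = "LINT x|M. f x * g x" and ?c = "LINT x|M. (g x)\<^sup>2"
  have i: "integrable M (\<lambda>x. (f x)\<^sup>2)" "integrable M (\<lambda>x. (g x)\<^sup>2)" "integrable M (\<lambda>x. f x * g x)"
    using assms sq_integrable_mult by (auto simp: sq_integrable_def)
  have quad: "0 \<le> ?a * s\<^sup>2 - 2 * ?b * s * r + ?c * r\<^sup>2" for s r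
  proof -
    have "0 \<le> (LINT x|M. (s * f x - r * g x)\<^sup>2)" by simp
    also have "(\<lambda>x. (s * f x - r * g x)\<^sup>2) =
        (\<lambda>x. s\<^sup>2 * (f x)\<^sup>2 - 2 * s * r * (f x * g x) + r\<^sup>2 * (g x)\<^sup>2)"
      by (rule ext) (simp add: power2_eq_square algebra_simps)
    also have "(LINT x|M. s\<^sup>2 * (f x)\<^sup>2 - 2 * s * r * (f x * g x) + r\<^sup>2 * (g x)\<^sup>2) =
        s\<^sup>2 * ?a - 2 * s * r * ?b + r\<^sup>2 * ?c"
      using i by simp
    finally show ?thesis by (simp add: algebra_simps)
  qed
  have a: "?a \<ge> 0" "?c \<ge> 0" by simp_all
  have "?b\<^sup>2 \<le> ?a * ?c"
  proof (cases "?c = 0")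
    case True
    have "?b = 0"
    proof (rule ccontr)
      assume b: "?b \<noteq> 0"
      have "2 * ?b\<^sup>2 * r \<le> ?a * ?b\<^sup>2" for r
        using quad[of "?b" r] True by (simp add: power2_eq_square algebra_simps)
      from this[of "?a"] have "?a * ?b\<^sup>2 \<le> 0" by (simp add: algebra_simps)
      moreover have "0 \<le> ?a * ?b\<^sup>2" by simp
      moreover note \<open>\<And>r. 2 * ?b\<^sup>2 * r \<le> ?a * ?b\<^sup>2\<close>[of 1]
      ultimately have "?b\<^sup>2 \<le> 0" by linarith
      with b show False by simp
    qed
    then show ?thesis by (simp add: True)
  next
    case False
    then have c: "?c > 0" using a by linarith
    have "0 \<le> ?c * (?a * ?c - ?b\<^sup>2)"
      using quad[of "?c" "?b"] by (simp add: power2_eq_square algebra_simps)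
    with c show ?thesis by (simp add: zero_le_mult_iff)
  qed
  then have "sqrt (?b\<^sup>2) \<le> sqrt (?a * ?c)" by (rule real_sqrt_le_mono)
  then show ?thesis by (simp add: sq_norm_def real_sqrt_mult)
qed

lemma sq_norm_triangle:
  assumes "sq_integrable M f" "sq_integrable M g"
  shows "sq_norm M (\<lambda>x. f x + g x) \<le> sq_norm M f + sq_norm M g"
proof (rule power2_le_imp_le)
  have i: "integrable M (\<lambda>x. (f x)\<^sup>2)" "integrable M (\<lambda>x. (g x)\<^sup>2)" "integrable M (\<lambda>x. f x * g x)"
    using assms sq_integrable_mult by (auto simp: sq_integrable_def)
  have "(sq_norm M (\<lambda>x. f x + g x))\<^sup>2 = (LINT x|M. (f x)\<^sup>2 + (g x)\<^sup>2 + 2 * (f x * g x))"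
    by (simp add: sq_norm_power2 power2_sum mult.assoc)
  also have "\<dots> = (sq_norm M f)\<^sup>2 + (sq_norm M g)\<^sup>2 + 2 * (LINT x|M. f x * g x)"
    using i by (simp add: sq_norm_power2)
  also have "\<dots> \<le> (sq_norm M f + sq_norm M g)\<^sup>2"
    using sq_Cauchy_Schwarz[OF assms] by (simp add: power2_sum)
  finally show "(sq_norm M (\<lambda>x. f x + g x))\<^sup>2 \<le> (sq_norm M f + sq_norm M g)\<^sup>2" .
qed (simp add: sq_norm_nonneg)

lemma sq_integrable_bounded:
  assumes "A \<in> sets M" "emeasure M A < \<infinity>" and [measurable]: "f \<in> borel_measurable M"
    and "AE x in M. \<bar>f x\<bar> \<le> c"
  shows "sq_integrable M (\<lambda>x. f x * indicator A x)"
proof -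
  have [measurable]: "A \<in> sets M" by fact
  have "integrable M (\<lambda>x. c\<^sup>2 * indicator A x :: real)"
    using assms by (intro integrable_mult_right) (simp add: integrable_indicator_iff)
  then have "integrable M (\<lambda>x. (f x * indicator A x)\<^sup>2)"
  proof (rule Bochner_Integration.integrable_bound)
    show "AE x in M. norm ((f x * indicator A x)\<^sup>2) \<le> norm (c\<^sup>2 * indicator A x :: real)"
      using assms(4)
    proof eventually_elim
      case (elim x)
      then have "(f x)\<^sup>2 \<le> c\<^sup>2"
        by (metis abs_ge_zero power2_abs power_mono)
      then show ?case by (simp split: split_indicator)
    qed
  qed simp
  then show ?thesis by (simp add: sq_integrable_def)
qed

lemma sq_integrable_indicator:
  assumes "A \<in> sets M" "emeasure M A < \<infinity>"
  shows "sq_integrable M (indicator A)"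
  using sq_integrable_bounded[of A M "\<lambda>_. 1" 1] assms by simp

lemma sq_integrable_cut:
  assumes "sq_integrable M f" and [measurable]: "A \<in> sets M"
  shows "sq_integrable M (\<lambda>x. f x * indicator A x)"
proof (rule sq_integrable_dominated(1)[OF assms(1)])
  have [measurable]: "f \<in> borel_measurable M" using assms(1) by (simp add: sq_integrable_def)
  show "(\<lambda>x. f x * indicator A x) \<in> borel_measurable M" by measurable
qed (auto split: split_indicator)

text \<open>For each sign \<open>s\<close> the test set is the part of a set of finite measure where \<open>s * (f - g)\<close> is
  positive; there the integral of a positive function vanishes.\<close>

lemma (in sigma_finite_measure) AE_eq_by_testing:
  assumes f: "sq_integrable M f" and g: "sq_integrable M g"
    and eq: "\<And>A. A \<in> sets M \<Longrightarrow> emeasure M A < \<infinity> \<Longrightarrow>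
               (LINT x|M. f x * indicator A x) = (LINT x|M. g x * indicator A x)"
  shows "AE x in M. f x = g x"
proof -
  obtain E :: "nat \<Rightarrow> 'a set" where E: "range E \<subseteq> sets M" "(\<Union>i. E i) = space M"
      "\<And>i. emeasure M (E i) \<noteq> \<infinity>" using sigma_finite by blast
  define h where "h = (\<lambda>x. f x - g x)"
  have h: "sq_integrable M h" unfolding h_def by (rule sq_integrable_diff[OF f g])
  have [measurable]: "h \<in> borel_measurable M" using h by (simp add: sq_integrable_def)
  have one: "AE x in M. x \<in> E i \<longrightarrow> s * h x \<le> 0" if s: "s = 1 \<or> s = (-1::real)" for s i
  proof -
    define A where "A = {x \<in> E i. s * h x > 0}"
    have [measurable]: "E i \<in> sets M" using E by auto
    have "A = {x\<in>space M. x \<in> E i \<and> s * h x > 0}"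
      unfolding A_def using sets.sets_into_space[OF \<open>E i \<in> sets M\<close>] by auto
    then have A[measurable]: "A \<in> sets M" by simp
    have fin: "emeasure M A < \<infinity>"
      using emeasure_mono[of A "E i" M] E(3)[of i] by (auto simp: A_def top.not_eq_extremum)
    note ind = sq_integrable_indicator[OF A fin]
    have i: "integrable M (\<lambda>x. f x * indicator A x)" "integrable M (\<lambda>x. g x * indicator A x)"
      using sq_integrable_mult[OF f ind] sq_integrable_mult[OF g ind] by auto
    then have ih: "integrable M (\<lambda>x. s * (h x * indicator A x))"
      by (auto simp: h_def left_diff_distrib)
    have "(LINT x|M. s * (h x * indicator A x)) = 0"
      using i eq[OF A fin] by (simp add: h_def left_diff_distrib)
    then have "AE x in M. s * (h x * indicator A x) = 0"
      by (subst (asm) integral_nonneg_eq_0_iff_AE[OF ih]) (auto simp: A_def split: split_indicator)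
    then show ?thesis
      by eventually_elim (auto simp: A_def split: split_indicator_asm)
  qed
  have "AE x in M. \<forall>i. x \<in> E i \<longrightarrow> 1 * h x \<le> 0" "AE x in M. \<forall>i. x \<in> E i \<longrightarrow> -1 * h x \<le> 0"
    unfolding AE_all_countable using one by blast+
  moreover have "AE x in M. x \<in> space M" by simp
  ultimately show ?thesis
  proof eventually_elim
    case (elim x)
    then obtain i where "x \<in> E i" using E(2) by blast
    with elim show ?case by (auto simp: h_def)
  qed
qed

text \<open>Monotone convergence, with the uniform bound on the truncated integrals replacing knowledge of
  their limit.\<close>

lemma integrable_of_bounded_exhaustion:
  fixes f :: "'a \<Rightarrow> real"
  assumes [measurable]: "f \<in> borel_measurable M" and nonneg: "\<And>x. 0 \<le> f x"
    and A: "range A \<subseteq> sets M" "incseq A" "space M \<subseteq> (\<Union>n. A n)"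
    and int: "\<And>n::nat. integrable M (\<lambda>x. f x * indicator (A n) x)"
    and le: "\<And>n. (LINT x|M. f x * indicator (A n) x) \<le> c"
  shows "integrable M f"
proof -
  let ?D = "density M (\<lambda>x. ennreal (f x))"
  have [measurable]: "A n \<in> sets M" for n using A(1) by auto
  have em: "emeasure ?D (A n) \<le> ennreal c" for n
  proof -
    have "emeasure ?D (A n) = (\<integral>\<^sup>+x. ennreal (f x * indicator (A n) x) \<partial>M)"
      by (subst emeasure_density) (auto intro!: nn_integral_cong split: split_indicator)
    also have "\<dots> = ennreal (LINT x|M. f x * indicator (A n) x)"
      by (intro nn_integral_eq_integral int) (auto simp: nonneg split: split_indicator)
    finally show ?thesis using le[of n] by (simp add: ennreal_leI)
  qed
  have "(\<Union>n. A n) = space M" using A(1,3) sets.sets_into_space by blast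
  then have "(\<integral>\<^sup>+x. ennreal (f x) \<partial>M) = emeasure ?D (\<Union>n. A n)"
    by (simp add: emeasure_density cong: nn_integral_cong)
  also have "\<dots> = (SUP n. emeasure ?D (A n))"
    by (rule SUP_emeasure_incseq[symmetric]) (use A in auto)
  also have "\<dots> \<le> ennreal c" by (rule SUP_least) (rule em)
  finally show ?thesis
    by (intro integrableI_bounded) (auto simp: nonneg le_less_trans)
qed

section \<open>Semigroups of positive kernel operators\<close>

lemma (in sigma_finite_measure) kernel_op_measurable:
  assumes [measurable]: "case_prod k \<in> borel_measurable (M \<Otimes>\<^sub>M M)" "f \<in> borel_measurable M"
  shows "kernel_op M k f \<in> borel_measurable M"
proof -
  have "(\<lambda>x. LINT y|M. k x y * f y) \<in> borel_measurable M"
  proof (rule borel_measurable_lebesgue_integral)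
    have "(\<lambda>z. case_prod k z * f (snd z)) \<in> borel_measurable (M \<Otimes>\<^sub>M M)" by measurable
    then show "(\<lambda>(x, y). k x y * f y) \<in> borel_measurable (M \<Otimes>\<^sub>M M)"
      by (simp add: case_prod_beta)
  qed
  then show ?thesis by (simp add: kernel_op_def [abs_def])
qed

text \<open>One of the two semigroups, seen through its kernel on real functions. Positivity is asked of
  the operators and not of the kernel pointwise.\<close>

locale positive_kernel = sigma_finite_measure \<mu>
  for \<mu> :: "'a::polish_space measure" +
  fixes u :: "real \<Rightarrow> 'a \<Rightarrow> 'a \<Rightarrow> real"
  assumes sets_borel [measurable_cong]: "sets \<mu> = sets borel"
    and support: "full_support \<mu>"
    and kernel_measurable: "t > 0 \<Longrightarrow> case_prod (u t) \<in> borel_measurable (\<mu> \<Otimes>\<^sub>M \<mu>)"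
    and op_integrable: "t > 0 \<Longrightarrow> sq_integrable \<mu> f \<Longrightarrow> AE x in \<mu>. integrable \<mu> (\<lambda>y. u t x y * f y)"
    and op_sq: "t > 0 \<Longrightarrow> sq_integrable \<mu> f \<Longrightarrow> sq_integrable \<mu> (kernel_op \<mu> (u t) f)"
    and op_nonneg: "t > 0 \<Longrightarrow> sq_integrable \<mu> f \<Longrightarrow> AE x in \<mu>. 0 \<le> f x \<Longrightarrow>
                      AE x in \<mu>. 0 \<le> kernel_op \<mu> (u t) f x"
    and op_semigroup: "s > 0 \<Longrightarrow> t > 0 \<Longrightarrow> sq_integrable \<mu> f \<Longrightarrow>
          AE x in \<mu>. kernel_op \<mu> (u (s + t)) f x = kernel_op \<mu> (u s) (kernel_op \<mu> (u t) f) x"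
    and feller: "strong_Feller \<mu> u"
begin

abbreviation P :: "real \<Rightarrow> ('a \<Rightarrow> real) \<Rightarrow> 'a \<Rightarrow> real" where
  "P t \<equiv> kernel_op \<mu> (u t)"

abbreviation T :: "real \<Rightarrow> ('a \<Rightarrow> real) \<Rightarrow> 'a \<Rightarrow> real" where
  "T \<equiv> Feller_op \<mu> u"

lemma space_UNIV: "space \<mu> = UNIV"
  using sets_eq_imp_space_eq[OF sets_borel] by simp

lemma slice_measurable:
  assumes "t > 0" shows "u t x \<in> borel_measurable \<mu>"
  using measurable_Pair2[OF kernel_measurable[OF assms], of x] by (simp add: space_UNIV)

lemma op_measurable:
  assumes "t > 0" and "f \<in> borel_measurable \<mu>"
  shows "P t f \<in> borel_measurable \<mu>"
  by (intro kernel_op_measurable kernel_measurable assms)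

lemma op_cong_AE:
  assumes "t > 0" and [measurable]: "f \<in> borel_measurable \<mu>" "g \<in> borel_measurable \<mu>"
    and "AE x in \<mu>. f x = g x"
  shows "P t f = P t g"
proof
  fix x
  have [measurable]: "u t x \<in> borel_measurable \<mu>" by (rule slice_measurable[OF assms(1)])
  show "P t f x = P t g x"
    unfolding kernel_op_def by (rule integral_cong_AE) (use assms(4) in auto)
qed

lemma op_scale: "P t (\<lambda>x. c * f x) = (\<lambda>x. c * P t f x)"
  by (rule ext) (simp add: kernel_op_def mult.left_commute)

lemma op_diff:
  assumes "t > 0" "sq_integrable \<mu> f" "sq_integrable \<mu> g"
  shows "AE x in \<mu>. P t (\<lambda>y. f y - g y) x = P t f x - P t g x"
  using op_integrable[OF assms(1,2)] op_integrable[OF assms(1,3)]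
  by eventually_elim (simp add: kernel_op_def right_diff_distrib)

lemma op_mono:
  assumes "t > 0" "sq_integrable \<mu> f" "sq_integrable \<mu> g" "AE x in \<mu>. f x \<le> g x"
  shows "AE x in \<mu>. P t f x \<le> P t g x"
proof -
  have "AE x in \<mu>. 0 \<le> P t (\<lambda>y. g y - f y) x"
    using assms(4) by (intro op_nonneg sq_integrable_diff assms) auto
  with op_diff[OF assms(1,3,2)] show ?thesis by eventually_elim simp
qed

lemma op_abs:
  assumes "t > 0" "sq_integrable \<mu> f"
  shows "AE x in \<mu>. \<bar>P t f x\<bar> \<le> P t (\<lambda>y. \<bar>f y\<bar>) x"
proof -
  have "AE x in \<mu>. P t f x \<le> P t (\<lambda>y. \<bar>f y\<bar>) x"
    by (intro op_mono sq_integrable_abs assms) auto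
  moreover have "AE x in \<mu>. P t (\<lambda>y. - 1 * f y) x \<le> P t (\<lambda>y. \<bar>f y\<bar>) x"
    by (intro op_mono sq_integrable_abs sq_integrable_scale assms) auto
  ultimately show ?thesis unfolding op_scale by eventually_elim auto
qed

lemma Linf_measurable: "f \<in> Linf \<mu> \<Longrightarrow> f \<in> borel_measurable \<mu>"
  by (simp add: Linf_def)

lemma Linf_bound:
  assumes "f \<in> Linf \<mu>" obtains c where "c \<ge> 0" "AE x in \<mu>. \<bar>f x\<bar> \<le> c"
proof -
  obtain c where "AE x in \<mu>. \<bar>f x\<bar> \<le> c" using assms by (auto simp: Linf_def)
  then have "AE x in \<mu>. \<bar>f x\<bar> \<le> max 0 c" by eventually_elim auto
  then show thesis using that[of "max 0 c"] by auto
qed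

lemma Linf_op_integrable:
  assumes "t > 0" "f \<in> Linf \<mu>" shows "AE x in \<mu>. integrable \<mu> (\<lambda>y. u t x y * f y)"
  using feller assms unfolding strong_Feller_def by blast

lemma Linf_diff:
  assumes "f \<in> Linf \<mu>" "g \<in> Linf \<mu>" shows "(\<lambda>x. f x - g x) \<in> Linf \<mu>"
proof -
  obtain a b where "AE x in \<mu>. \<bar>f x\<bar> \<le> a" "AE x in \<mu>. \<bar>g x\<bar> \<le> b"
    using assms by (auto simp: Linf_def)
  then have "AE x in \<mu>. \<bar>f x - g x\<bar> \<le> a + b" by eventually_elim simp
  with assms show ?thesis by (auto simp: Linf_def)
qed

lemma Linf_scale:
  assumes "f \<in> Linf \<mu>" shows "(\<lambda>x. c * f x) \<in> Linf \<mu>"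
proof -
  obtain a where "AE x in \<mu>. \<bar>f x\<bar> \<le> a" using assms by (auto simp: Linf_def)
  then have "AE x in \<mu>. \<bar>c * f x\<bar> \<le> \<bar>c\<bar> * a"
    by eventually_elim (simp add: abs_mult mult_left_mono)
  with assms show ?thesis by (auto simp: Linf_def)
qed

lemma Linf_const: "(\<lambda>_. c) \<in> Linf \<mu>"
  by (auto simp: Linf_def)

lemma Linf_indicator: "A \<in> sets \<mu> \<Longrightarrow> indicator A \<in> Linf \<mu>"
  by (auto simp: Linf_def indicator_def intro!: exI[of _ 1])

text \<open>An exhaustion of the space by sets of finite measure; it links bounded functions, which need
  not be square integrable, with \<open>L\<^sup>2\<close>.\<close>

definition E :: "nat \<Rightarrow> 'a set" where
  "E = (SOME A. range A \<subseteq> sets \<mu> \<and> (\<Union>i. A i) = UNIV \<and> (\<forall>i. emeasure \<mu> (A i) < \<infinity>) \<and> incseq A)"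

lemma E_spec: "range E \<subseteq> sets \<mu> \<and> (\<Union>i. E i) = UNIV \<and> (\<forall>i. emeasure \<mu> (E i) < \<infinity>) \<and> incseq E"
proof -
  obtain A :: "nat \<Rightarrow> 'a set" where "range A \<subseteq> sets \<mu>" "(\<Union>i. A i) = space \<mu>"
      "\<And>i. emeasure \<mu> (A i) \<noteq> \<infinity>" "incseq A"
    using sigma_finite_incseq by blast
  then have "\<exists>A. range A \<subseteq> sets \<mu> \<and> (\<Union>i. A i) = UNIV \<and> (\<forall>i::nat. emeasure \<mu> (A i) < \<infinity>) \<and> incseq A"
    by (intro exI[of _ A]) (auto simp: space_UNIV top.not_eq_extremum)
  then show ?thesis unfolding E_def by (rule someI_ex)
qed

lemma E_sets [measurable]: "E n \<in> sets \<mu>" and E_finite: "emeasure \<mu> (E n) < \<infinity>"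
  using E_spec by auto

lemma E_eventually: "\<forall>\<^sub>F n in sequentially. x \<in> E n"
proof -
  obtain i where "x \<in> E i" using E_spec by blast
  then have "x \<in> E n" if "n \<ge> i" for n
    using E_spec that by (meson incseq_def subsetD)
  then show ?thesis by (auto simp: eventually_sequentially)
qed

lemma E_cut_tendsto: "(\<lambda>n. f x * indicator (E n) x) \<longlonglongrightarrow> (f x :: real)"
proof (rule tendsto_eventually)
  show "\<forall>\<^sub>F n in sequentially. f x * indicator (E n) x = f x"
    using E_eventually[of x] by eventually_elim simp
qed

lemma Linf_cut_sq:
  assumes "f \<in> Linf \<mu>" shows "sq_integrable \<mu> (\<lambda>x. f x * indicator (E n) x)"
proof -
  obtain a where "AE x in \<mu>. \<bar>f x\<bar> \<le> a" using assms by (auto simp: Linf_def)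
  then show ?thesis
    by (intro sq_integrable_bounded[where c=a] E_sets E_finite Linf_measurable[OF assms])
qed

text \<open>Strong Feller kernels are integrable in the second variable, so the operator on bounded
  functions is a pointwise limit of the operator on \<open>L\<^sup>2\<close>. Positivity passes from \<open>L\<^sup>2\<close> to \<open>L\<^sup>\<infinity>\<close> in
  this way.\<close>

lemma op_cut_tendsto:
  assumes "t > 0" "f \<in> Linf \<mu>"
  shows "AE x in \<mu>. (\<lambda>n. P t (\<lambda>y. f y * indicator (E n) y) x) \<longlonglongrightarrow> P t f x"
  using Linf_op_integrable[OF assms]
proof eventually_elim
  case (elim x)
  have [measurable]: "u t x \<in> borel_measurable \<mu>" "f \<in> borel_measurable \<mu>"
    using slice_measurable Linf_measurable assms by auto
  show ?case
    unfolding kernel_op_def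
  proof (rule integral_dominated_convergence[where w="\<lambda>y. \<bar>u t x y * f y\<bar>"])
    show "AE y in \<mu>. (\<lambda>n. u t x y * (f y * indicator (E n) y)) \<longlonglongrightarrow> u t x y * f y"
      by (intro AE_I2 tendsto_mult_left E_cut_tendsto)
  qed (use elim integrable_abs[OF elim] in \<open>auto split: split_indicator simp: abs_mult\<close>)
qed

lemma Linf_op_nonneg:
  assumes "t > 0" "f \<in> Linf \<mu>" "AE x in \<mu>. 0 \<le> f x"
  shows "AE x in \<mu>. 0 \<le> P t f x"
proof -
  have "AE x in \<mu>. \<forall>n. 0 \<le> P t (\<lambda>y. f y * indicator (E n) y) x"
    unfolding AE_all_countable
  proof
    fix n
    show "AE x in \<mu>. 0 \<le> P t (\<lambda>y. f y * indicator (E n) y) x"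
      by (intro op_nonneg Linf_cut_sq assms) (use assms(3) in auto)
  qed
  with op_cut_tendsto[OF assms(1,2)] show ?thesis
    by eventually_elim (rule LIMSEQ_le_const, assumption, auto)
qed

lemma Linf_op_diff:
  assumes "t > 0" "f \<in> Linf \<mu>" "g \<in> Linf \<mu>"
  shows "AE x in \<mu>. P t (\<lambda>y. f y - g y) x = P t f x - P t g x"
  using Linf_op_integrable[OF assms(1,2)] Linf_op_integrable[OF assms(1,3)]
  by eventually_elim (simp add: kernel_op_def right_diff_distrib)

lemma Linf_op_mono:
  assumes "t > 0" "f \<in> Linf \<mu>" "g \<in> Linf \<mu>" "AE x in \<mu>. f x \<le> g x"
  shows "AE x in \<mu>. P t f x \<le> P t g x"
proof -
  have "AE x in \<mu>. 0 \<le> P t (\<lambda>y. g y - f y) x"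
    using assms(4) by (intro Linf_op_nonneg Linf_diff assms) auto
  with Linf_op_diff[OF assms(1,3,2)] show ?thesis by eventually_elim simp
qed

lemma Linf_op_bound:
  assumes "t > 0" and [measurable]: "f \<in> borel_measurable \<mu>" and le: "AE x in \<mu>. \<bar>f x\<bar> \<le> c"
  shows "AE x in \<mu>. \<bar>P t f x\<bar> \<le> c * P t (\<lambda>_. 1) x"
proof -
  have f: "f \<in> Linf \<mu>" using le by (auto simp: Linf_def)
  have le': "AE x in \<mu>. f x \<le> c * 1" "AE x in \<mu>. - 1 * f x \<le> c * 1"
    using le by (eventually_elim, simp)+
  have "AE x in \<mu>. P t f x \<le> P t (\<lambda>y. c * 1) x"
    by (intro Linf_op_mono Linf_const f assms(1) le')
  moreover have "AE x in \<mu>. P t (\<lambda>y. - 1 * f y) x \<le> P t (\<lambda>y. c * 1) x"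
    by (intro Linf_op_mono Linf_const Linf_scale f assms(1) le')
  ultimately show ?thesis unfolding op_scale by eventually_elim auto
qed

text \<open>The set where the inequality fails is open, and \<open>\<mu>\<close> charges every nonempty open set.\<close>

lemma continuous_AE_le:
  fixes f g :: "'a \<Rightarrow> real"
  assumes "continuous_on UNIV f" "continuous_on UNIV g" and le: "AE x in \<mu>. f x \<le> g x"
  shows "f x \<le> g x"
proof (rule ccontr)
  let ?V = "{x. g x < f x}"
  assume "\<not> f x \<le> g x"
  then have "x \<in> ?V" by simp
  then have ne: "?V \<noteq> {}" by blast
  have op: "open ?V" using open_Collect_less[OF assms(2,1)] .
  then have V: "?V \<in> sets \<mu>" by (simp add: sets_borel)
  have "AE x in \<mu>. x \<notin> ?V" using le by eventually_elim auto
  then have "emeasure \<mu> ?V = 0"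
    using AE_iff_measurable[OF V, of "\<lambda>x. x \<notin> ?V"] by (simp add: space_UNIV)
  moreover have "emeasure \<mu> ?V > 0"
    using support op ne by (auto simp: full_support_def)
  ultimately show False by simp
qed

lemma T_spec:
  assumes "t > 0" "f \<in> Linf \<mu>"
  shows "continuous_on UNIV (T t f)" "AE x in \<mu>. P t f x = T t f x" "bounded (range (T t f))"
proof -
  let ?Q = "\<lambda>g. continuous_on UNIV g \<and> (AE x in \<mu>. P t f x = g x)"
  obtain g where g: "?Q g" "bounded (range g)"
    using feller assms unfolding strong_Feller_def by blast
  have unique: "h = g" if "?Q h" for h
  proof
    fix x
    have "AE x in \<mu>. P t f x = h x" "AE x in \<mu>. P t f x = g x" using that g(1) by auto
    then have "AE x in \<mu>. h x \<le> g x" "AE x in \<mu>. g x \<le> h x"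
      by (eventually_elim, simp)+
    then have "h x \<le> g x" "g x \<le> h x"
      using that g(1) continuous_AE_le[of h g] continuous_AE_le[of g h] by blast+
    then show "h x = g x" by simp
  qed
  have "T t f = g" unfolding Feller_op_def by (rule the_equality[where P="?Q"], rule g(1), rule unique)
  then show "continuous_on UNIV (T t f)" "AE x in \<mu>. P t f x = T t f x" "bounded (range (T t f))"
    using g by simp_all
qed

lemma T_eqI:
  assumes "t > 0" "f \<in> Linf \<mu>" and g: "continuous_on UNIV g" and eq: "AE x in \<mu>. P t f x = g x"
  shows "T t f = g"
proof
  fix x
  have "AE x in \<mu>. T t f x \<le> g x" "AE x in \<mu>. g x \<le> T t f x"
    using T_spec(2)[OF assms(1,2)] eq by (eventually_elim, simp)+
  then have "T t f x \<le> g x" "g x \<le> T t f x"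
    using T_spec(1)[OF assms(1,2)] g continuous_AE_le[of "T t f" g] continuous_AE_le[of g "T t f"] by blast+
  then show "T t f x = g x" by simp
qed

lemma not_AE_False: "\<not> (AE x in \<mu>. False)"
proof
  assume "AE x in \<mu>. False"
  then have "AE x in \<mu>. (1::real) \<le> 0" by simp
  from continuous_AE_le[OF _ _ this] show False by simp
qed

lemma T_measurable:
  assumes "t > 0" "f \<in> Linf \<mu>" shows "T t f \<in> borel_measurable \<mu>"
  using borel_measurable_continuous_onI[OF T_spec(1)[OF assms]]
  by (simp add: measurable_cong_sets[OF sets_borel refl])

lemma T_one_nonneg:
  assumes "t > 0" shows "0 \<le> T t (\<lambda>_. 1) x"
proof (rule continuous_AE_le[of "\<lambda>_. 0"])
  have "AE x in \<mu>. 0 \<le> P t (\<lambda>_. 1) x" by (intro Linf_op_nonneg Linf_const assms) auto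
  with T_spec(2)[OF assms Linf_const[of 1]] show "AE x in \<mu>. 0 \<le> T t (\<lambda>_. 1) x"
    by eventually_elim simp
qed (simp_all add: T_spec(1)[OF assms Linf_const[of 1]])

lemma integral_cut_tendsto:
  assumes "integrable \<mu> w" "f \<in> Linf \<mu>"
  shows "(\<lambda>n. LINT x|\<mu>. w x * (f x * indicator (E n) x)) \<longlonglongrightarrow> (LINT x|\<mu>. w x * f x)"
proof -
  obtain c where c: "c \<ge> 0" "AE x in \<mu>. \<bar>f x\<bar> \<le> c" using Linf_bound[OF assms(2)] .
  have [measurable]: "w \<in> borel_measurable \<mu>" "f \<in> borel_measurable \<mu>"
    using assms Linf_measurable by auto
  show ?thesis
  proof (rule integral_dominated_convergence[where w="\<lambda>x. \<bar>w x\<bar> * c"])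
    show "AE x in \<mu>. norm (w x * (f x * indicator (E n) x)) \<le> \<bar>w x\<bar> * c" for n
      using c(2) by eventually_elim
        (use c(1) in \<open>auto split: split_indicator simp: abs_mult mult_left_mono\<close>)
    show "AE x in \<mu>. (\<lambda>n. w x * (f x * indicator (E n) x)) \<longlonglongrightarrow> w x * f x"
      by (intro AE_I2 tendsto_mult_left E_cut_tendsto)
  qed (use assms(1) in auto)
qed

lemma integral_op_cut_tendsto:
  assumes t: "t > 0" and w: "integrable \<mu> w" and f: "f \<in> Linf \<mu>"
  shows "(\<lambda>n. LINT x|\<mu>. w x * P t (\<lambda>y. f y * indicator (E n) y) x) \<longlonglongrightarrow> (LINT x|\<mu>. w x * P t f x)"
proof -
  obtain c where c: "c \<ge> 0" "AE x in \<mu>. \<bar>f x\<bar> \<le> c" using Linf_bound[OF f] .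
  obtain b where b: "\<And>x. \<bar>T t (\<lambda>_. 1) x\<bar> \<le> b"
    using T_spec(3)[OF t Linf_const[of 1]] unfolding bounded_iff by auto
  have [measurable]: "w \<in> borel_measurable \<mu>" "f \<in> borel_measurable \<mu>"
    using w f Linf_measurable by auto
  have [measurable]: "P t f \<in> borel_measurable \<mu>"
      "P t (\<lambda>y. f y * indicator (E n) y) \<in> borel_measurable \<mu>" for n
    using t by (auto intro!: op_measurable)
  show ?thesis
  proof (rule integral_dominated_convergence[where w="\<lambda>x. \<bar>w x\<bar> * (c * b)"])
    fix n
    have "AE x in \<mu>. \<bar>f x * indicator (E n) x\<bar> \<le> c"
      using c(2) by eventually_elim (use c(1) in \<open>auto split: split_indicator\<close>)
    then have "AE x in \<mu>. \<bar>P t (\<lambda>y. f y * indicator (E n) y) x\<bar> \<le> c * P t (\<lambda>_. 1) x"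
      by (intro Linf_op_bound t) auto
    with T_spec(2)[OF t Linf_const[of 1]]
    show "AE x in \<mu>. norm (w x * P t (\<lambda>y. f y * indicator (E n) y) x) \<le> \<bar>w x\<bar> * (c * b)"
    proof eventually_elim
      case (elim x)
      have "c * T t (\<lambda>_. 1) x \<le> c * b" using b[of x] c(1) by (intro mult_left_mono) auto
      with elim have "\<bar>P t (\<lambda>y. f y * indicator (E n) y) x\<bar> \<le> c * b" by simp
      then show ?case by (simp add: abs_mult mult_left_mono)
    qed
  next
    show "AE x in \<mu>. (\<lambda>n. w x * P t (\<lambda>y. f y * indicator (E n) y) x) \<longlonglongrightarrow> w x * P t f x"
      using op_cut_tendsto[OF t f] by eventually_elim (rule tendsto_mult_left)
  qed (use w in auto)
qed

end

section \<open>Small times and eigenvectors of the generator\<close>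

context positive_kernel begin

text \<open>The uniform boundedness principle for positive operators. If the bound failed, there would be
  times tending to \<open>0\<close> and nonnegative functions \<open>g n\<close> of norm \<open>1 / 2 ^ n\<close> whose images have norm at
  least \<open>n + 1\<close>. A square-integrable majorant \<open>F\<close> of all \<open>g n\<close> has images at least as large, which
  contradicts strong continuity at \<open>F\<close>.\<close>

lemma small_time_bound:
  assumes sc: "\<And>f. sq_integrable \<mu> f \<Longrightarrow> ((\<lambda>t. sq_norm \<mu> (\<lambda>x. P t f x - f x)) \<longlongrightarrow> 0) (at_right 0)"
  shows "\<exists>B>0. \<exists>d>0. \<forall>t f. 0 < t \<longrightarrow> t \<le> d \<longrightarrow> sq_integrable \<mu> f \<longrightarrow>
           sq_norm \<mu> (P t f) \<le> B * sq_norm \<mu> f"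
proof (rule ccontr)
  assume neg: "\<not> ?thesis"
  have "\<exists>t f. 0 < t \<and> t \<le> 1 / real (Suc n) \<and> sq_integrable \<mu> f \<and>
          (real n + 1) * 2 ^ n * sq_norm \<mu> f < sq_norm \<mu> (P t f)" for n
  proof (rule ccontr)
    assume "\<not> ?thesis"
    then have "\<forall>t f. 0 < t \<longrightarrow> t \<le> 1 / real (Suc n) \<longrightarrow> sq_integrable \<mu> f \<longrightarrow>
        sq_norm \<mu> (P t f) \<le> ((real n + 1) * 2 ^ n) * sq_norm \<mu> f"
      by (meson not_less)
    moreover have "(real n + 1) * 2 ^ n > 0" "1 / real (Suc n) > 0" by (simp_all add: add_pos_nonneg)
    ultimately show False using neg by blast
  qed
  then obtain t f where tf: "\<And>n. 0 < t n" "\<And>n. t n \<le> 1 / real (Suc n)" "\<And>n. sq_integrable \<mu> (f n)"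
      "\<And>n. (real n + 1) * 2 ^ n * sq_norm \<mu> (f n) < sq_norm \<mu> (P (t n) (f n))"
    by metis
  have pos: "sq_norm \<mu> (f n) > 0" for n
  proof (rule ccontr)
    assume "\<not> ?thesis"
    then have z: "sq_norm \<mu> (f n) = 0" using sq_norm_nonneg[of \<mu> "f n"] by simp
    have m: "f n \<in> borel_measurable \<mu>" using tf(3) by (simp add: sq_integrable_def)
    have "P (t n) (f n) = P (t n) (\<lambda>_. 0)"
      by (rule op_cong_AE[OF tf(1)[of n] m]) (use sq_norm_eq_0[OF tf(3) z] in auto)
    then have "sq_norm \<mu> (P (t n) (f n)) = 0" by (simp add: kernel_op_def [abs_def] sq_norm_def)
    with tf(4)[of n] z show False by simp
  qed
  \<comment> \<open>The factor \<open>2 ^ n\<close> in the choice of \<open>f n\<close> pays for normalizing to the summable norms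
    \<open>1 / 2 ^ n\<close>.\<close>
  define c where "c n = 1 / (2 ^ n * sq_norm \<mu> (f n))" for n
  define g where "g n = (\<lambda>x. c n * \<bar>f n x\<bar>)" for n
  have c: "c n > 0" for n using pos by (simp add: c_def)
  have g: "sq_integrable \<mu> (g n)" for n
    unfolding g_def by (intro sq_integrable_scale sq_integrable_abs tf(3))
  have g0: "0 \<le> g n x" for n x using c[of n] by (simp add: g_def)
  have [measurable]: "g n \<in> borel_measurable \<mu>" for n using g by (simp add: sq_integrable_def)
  have norm_g: "sq_norm \<mu> (g n) = 1 / 2 ^ n" for n
  proof -
    have "sq_norm \<mu> (g n) = \<bar>c n\<bar> * sq_norm \<mu> (f n)"
      unfolding g_def sq_norm_scale sq_norm_abs ..
    then show ?thesis using pos[of n] c[of n] by (simp add: c_def)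
  qed
  have big: "real n + 1 \<le> sq_norm \<mu> (P (t n) (g n))" for n
  proof -
    have "sq_norm \<mu> (P (t n) (f n)) \<le> sq_norm \<mu> (P (t n) (\<lambda>x. \<bar>f n x\<bar>))"
    proof (rule sq_integrable_dominated(2))
      show "sq_integrable \<mu> (P (t n) (\<lambda>x. \<bar>f n x\<bar>))" by (intro op_sq sq_integrable_abs tf)
      show "P (t n) (f n) \<in> borel_measurable \<mu>"
        using op_sq[OF tf(1)[of n] tf(3)[of n]] by (simp add: sq_integrable_def)
      show "AE x in \<mu>. \<bar>P (t n) (f n) x\<bar> \<le> \<bar>P (t n) (\<lambda>x. \<bar>f n x\<bar>) x\<bar>"
        using op_abs[OF tf(1)[of n] tf(3)[of n]] by eventually_elim linarith
    qed
    then have "(real n + 1) * 2 ^ n * sq_norm \<mu> (f n) \<le> sq_norm \<mu> (P (t n) (\<lambda>x. \<bar>f n x\<bar>))"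
      using tf(4)[of n] by linarith
    then have "c n * ((real n + 1) * 2 ^ n * sq_norm \<mu> (f n)) \<le>
        c n * sq_norm \<mu> (P (t n) (\<lambda>x. \<bar>f n x\<bar>))"
      using c[of n] by (intro mult_left_mono) auto
    moreover have "c n * ((real n + 1) * 2 ^ n * sq_norm \<mu> (f n)) = real n + 1"
      using pos[of n] by (simp add: c_def)
    moreover have "sq_norm \<mu> (P (t n) (g n)) = c n * sq_norm \<mu> (P (t n) (\<lambda>x. \<bar>f n x\<bar>))"
      unfolding g_def op_scale sq_norm_scale using c[of n] by simp
    ultimately show ?thesis by linarith
  qed
  \<comment> \<open>A single function dominating all \<open>g n\<close>: the pointwise \<open>\<ell>\<^sup>2\<close>-norm of the sequence.\<close>
  define G where "G x = (\<Sum>n. ennreal ((g n x)\<^sup>2))" for x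
  define F where "F x = sqrt (enn2real (G x))" for x
  have G_int: "(\<integral>\<^sup>+x. G x \<partial>\<mu>) < \<infinity>"
  proof -
    have eq: "(\<integral>\<^sup>+x. ennreal ((g n x)\<^sup>2) \<partial>\<mu>) = ennreal ((1/4) ^ n)" for n
    proof -
      have "integrable \<mu> (\<lambda>x. (g n x)\<^sup>2)" using g by (simp add: sq_integrable_def)
      then have "(\<integral>\<^sup>+x. ennreal ((g n x)\<^sup>2) \<partial>\<mu>) = ennreal (LINT x|\<mu>. (g n x)\<^sup>2)"
        by (intro nn_integral_eq_integral) auto
      also have "(LINT x|\<mu>. (g n x)\<^sup>2) = (1 / 2 ^ n)\<^sup>2"
        using sq_norm_power2[of \<mu> "g n"] by (simp add: norm_g)
      also have "(1 / 2 ^ n)\<^sup>2 = (1/4 :: real) ^ n"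
        by (simp add: power_divide power2_eq_square flip: power_mult_distrib)
      finally show ?thesis .
    qed
    have "(\<integral>\<^sup>+x. G x \<partial>\<mu>) = (\<Sum>n. ennreal ((1/4) ^ n))"
      unfolding G_def eq[symmetric] by (rule nn_integral_suminf) measurable
    also have "\<dots> = ennreal (\<Sum>n. (1/4) ^ n)"
      by (intro suminf_ennreal2 summable_geometric) auto
    finally show ?thesis by simp
  qed
  have [measurable]: "G \<in> borel_measurable \<mu>" unfolding G_def by measurable
  have [measurable]: "F \<in> borel_measurable \<mu>" unfolding F_def by measurable
  have G_fin: "AE x in \<mu>. G x \<noteq> \<infinity>"
    using G_int by (intro nn_integral_PInf_AE) auto
  have F: "sq_integrable \<mu> F"
  proof -
    have "(\<integral>\<^sup>+x. ennreal (norm ((F x)\<^sup>2)) \<partial>\<mu>) \<le> (\<integral>\<^sup>+x. G x \<partial>\<mu>)"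
      using G_fin by (intro nn_integral_mono_AE, eventually_elim) (simp add: F_def less_top)
    then have "integrable \<mu> (\<lambda>x. (F x)\<^sup>2)"
      using G_int by (intro integrableI_bounded) (auto simp: le_less_trans)
    then show ?thesis by (simp add: sq_integrable_def)
  qed
  have gF: "AE x in \<mu>. g n x \<le> F x" for n
    using G_fin
  proof eventually_elim
    case (elim x)
    have "ennreal ((g n x)\<^sup>2) = (\<Sum>k\<in>{n}. ennreal ((g k x)\<^sup>2))" by simp
    also have "\<dots> \<le> G x" unfolding G_def by (intro sum_le_suminf) auto
    finally have "(g n x)\<^sup>2 \<le> enn2real (G x)"
      using elim by (metis enn2real_ennreal enn2real_mono infinity_ennreal_def less_top zero_le_power2)
    then show ?case unfolding F_def by (rule real_le_rsqrt)
  qed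
  have low: "real n + 1 \<le> sq_norm \<mu> (P (t n) F)" for n
  proof -
    have "sq_norm \<mu> (P (t n) (g n)) \<le> sq_norm \<mu> (P (t n) F)"
    proof (rule sq_integrable_dominated(2))
      show "sq_integrable \<mu> (P (t n) F)" by (intro op_sq F tf)
      show "P (t n) (g n) \<in> borel_measurable \<mu>"
        using op_sq[OF tf(1)[of n] g[of n]] by (simp add: sq_integrable_def)
      have "AE x in \<mu>. P (t n) (g n) x \<le> P (t n) F x" by (intro op_mono tf g F gF)
      moreover have "AE x in \<mu>. 0 \<le> P (t n) (g n) x" by (intro op_nonneg tf g) (simp add: g0)
      ultimately show "AE x in \<mu>. \<bar>P (t n) (g n) x\<bar> \<le> \<bar>P (t n) F x\<bar>" by eventually_elim simp
    qed
    with big[of n] show ?thesis by linarith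
  qed
  have tri: "sq_norm \<mu> (P (t n) F) \<le> sq_norm \<mu> (\<lambda>x. P (t n) F x - F x) + sq_norm \<mu> F" for n
    using sq_norm_triangle[OF sq_integrable_diff[OF op_sq[OF tf(1)[of n] F] F] F] by simp
  have lower: "real n + 1 - sq_norm \<mu> F \<le> sq_norm \<mu> (\<lambda>x. P (t n) F x - F x)" for n
    using low[of n] tri[of n] by linarith
  have "t \<longlonglongrightarrow> 0"
  proof (rule real_tendsto_sandwich[of "\<lambda>_. 0" t sequentially "\<lambda>n. 1 / real (Suc n)"])
    show "(\<lambda>n. 1 / real (Suc n)) \<longlonglongrightarrow> 0" by (rule lim_1_over_n[THEN LIMSEQ_Suc])
  qed (use tf(1,2) in \<open>auto intro!: always_eventually less_imp_le\<close>)
  then have "filterlim t (at_right 0) sequentially"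
    using tf(1) by (auto simp: filterlim_at less_imp_neq[THEN not_sym] intro!: always_eventually)
  then have "(\<lambda>n. sq_norm \<mu> (\<lambda>x. P (t n) F x - F x)) \<longlonglongrightarrow> 0"
    by (rule filterlim_compose[OF sc[OF F]])
  then have "\<forall>\<^sub>F n in sequentially. sq_norm \<mu> (\<lambda>x. P (t n) F x - F x) < 1"
    by (rule order_tendstoD) simp
  moreover have "\<forall>\<^sub>F n in sequentially. sq_norm \<mu> F < real n"
    by (rule filterlim_at_top_dense[THEN iffD1, rule_format, OF filterlim_real_sequentially])
  ultimately have "\<forall>\<^sub>F n :: nat in sequentially. False"
  proof eventually_elim
    case (elim n)
    with lower[of n] show ?case by linarith
  qed
  then show False by simp
qed

text \<open>With \<open>V t = exp (l * t) P t\<close> the eigenvector equation says \<open>V s f - f = o(s)\<close>. Telescoping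
  \<open>V t f - f\<close> into \<open>n\<close> steps of length \<open>t / n\<close> and bounding the operators in front gives
  \<open>n \<cdot> o(t / n) \<rightarrow> 0\<close> for short times; longer times follow by iteration.\<close>

lemma eigenvector_of_generator:
  assumes bound: "B > 0" "d > 0" "\<And>t f. 0 < t \<Longrightarrow> t \<le> d \<Longrightarrow> sq_integrable \<mu> f \<Longrightarrow>
           sq_norm \<mu> (P t f) \<le> B * sq_norm \<mu> f"
    and f: "sq_integrable \<mu> f"
    and gen: "((\<lambda>t. sq_norm \<mu> (\<lambda>x. (P t f x - f x) / t + l * f x)) \<longlongrightarrow> 0) (at_right 0)"
    and "t > 0"
  shows "AE x in \<mu>. P t f x = exp (- l * t) * f x"
proof -
  define V where "V t g x = exp (l * t) * P t g x" for t g x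
  have V_sq: "sq_integrable \<mu> (V t g)" if "t > 0" "sq_integrable \<mu> g" for t g
    unfolding V_def by (intro sq_integrable_scale op_sq that)
  define D where "D t x = V t f x - f x" for t x
  have D_sq: "sq_integrable \<mu> (D t)" if "t > 0" for t
    unfolding D_def by (intro sq_integrable_diff V_sq f that)
  define C where "C = exp (\<bar>l\<bar> * d) * B + 1"
  have C: "C \<ge> 1" using bound(1) by (simp add: C_def)
  have VC: "sq_norm \<mu> (V t g) \<le> C * sq_norm \<mu> g" if "0 < t" "t \<le> d" "sq_integrable \<mu> g" for t g
  proof -
    have "l * t \<le> \<bar>l\<bar> * d" using that bound(2) by (intro mult_mono) auto
    then have "exp (l * t) * sq_norm \<mu> (P t g) \<le> exp (\<bar>l\<bar> * d) * (B * sq_norm \<mu> g)"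
      using that bound by (intro mult_mono) (auto simp: sq_norm_nonneg)
    moreover have "sq_norm \<mu> (V t g) = exp (l * t) * sq_norm \<mu> (P t g)"
      unfolding V_def sq_norm_scale by simp
    moreover have "C * sq_norm \<mu> g = exp (\<bar>l\<bar> * d) * (B * sq_norm \<mu> g) + sq_norm \<mu> g"
      by (simp add: C_def algebra_simps)
    ultimately show ?thesis using sq_norm_nonneg[of \<mu> g] by linarith
  qed
  have V_comp: "AE x in \<mu>. V (s + r) f x = V s (V r f) x" if "s > 0" "r > 0" for s r
    using op_semigroup[OF that f]
    by eventually_elim (simp add: V_def [abs_def] op_scale exp_add ring_distribs mult.assoc)
  have small: "((\<lambda>t. sq_norm \<mu> (D t) / t) \<longlongrightarrow> 0) (at_right 0)"
  proof (rule real_tendsto_sandwich)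
    let ?N = "\<lambda>t. sq_norm \<mu> (\<lambda>x. (P t f x - f x) / t + l * f x)"
    let ?e = "\<lambda>t. (exp (l * t) * (1 - l * t) - 1) / t"
    show "\<forall>\<^sub>F t in at_right 0. 0 \<le> sq_norm \<mu> (D t) / t"
      by (auto simp: eventually_at_right_less sq_norm_nonneg intro!: eventually_mono[OF eventually_at_right_less] divide_nonneg_pos)
    show "\<forall>\<^sub>F t in at_right 0. sq_norm \<mu> (D t) / t \<le> exp (l * t) * ?N t + \<bar>?e t\<bar> * sq_norm \<mu> f"
      using eventually_at_right_less[of 0]
    proof eventually_elim
      case (elim t)
      have R: "sq_integrable \<mu> (\<lambda>x. (P t f x - f x) / t + l * f x)"
        using sq_integrable_add[OF sq_integrable_scale[OF sq_integrable_diff[OF op_sq[OF elim f] f], of "1/t"]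
            sq_integrable_scale[OF f, of l]] by simp
      \<comment> \<open>Comparing the difference quotient of \<open>V\<close> with that of \<open>P\<close> costs a scalar multiple of \<open>f\<close>
        that is of second order in \<open>t\<close>.\<close>
      have "D t = (\<lambda>x. (t * exp (l * t)) * ((P t f x - f x) / t + l * f x) + (t * ?e t) * f x)"
        using elim by (auto simp: D_def V_def field_simps)
      then have "sq_norm \<mu> (D t) \<le> (t * exp (l * t)) * ?N t + (t * \<bar>?e t\<bar>) * sq_norm \<mu> f"
        using sq_norm_triangle[OF sq_integrable_scale[OF R] sq_integrable_scale[OF f], of "t * exp (l * t)" "t * ?e t"] elim
        by (simp add: sq_norm_scale abs_mult)
      also have "\<dots> = (exp (l * t) * ?N t + \<bar>?e t\<bar> * sq_norm \<mu> f) * t"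
        by (simp add: algebra_simps)
      finally show ?case using elim by (simp only: pos_divide_le_eq)
    qed
    have e: "(?e \<longlongrightarrow> 0) (at_right 0)" by real_asymp
    have "((\<lambda>t. exp (l * t)) \<longlongrightarrow> 1) (at_right 0)" by real_asymp
    then have "((\<lambda>t. exp (l * t) * ?N t + \<bar>?e t\<bar> * sq_norm \<mu> f) \<longlongrightarrow> 1 * 0 + \<bar>0\<bar> * sq_norm \<mu> f) (at_right 0)"
      by (intro tendsto_intros gen e)
    then show "((\<lambda>t. exp (l * t) * ?N t + \<bar>?e t\<bar> * sq_norm \<mu> f) \<longlongrightarrow> 0) (at_right 0)" by simp
  qed simp
  have telescope: "sq_norm \<mu> (D (real (Suc n) * s)) \<le> real (Suc n) * C * sq_norm \<mu> (D s)"
    if "s > 0" "real (Suc n) * s \<le> d" for n s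
    using that(2)
  proof (induction n)
    case 0
    show ?case using mult_right_mono[OF C sq_norm_nonneg[of \<mu> "D s"]] by simp
  next
    case (Suc n)
    define r where "r = real (Suc n) * s"
    have r_pos: "r > 0" using that(1) by (simp add: r_def)
    have r_Suc: "real (Suc (Suc n)) * s = r + s" by (simp add: r_def algebra_simps)
    have r: "r > 0" "r \<le> d" "real (Suc (Suc n)) * s = r + s"
      using Suc.prems that(1) r_pos r_Suc by auto
    have IH: "sq_norm \<mu> (D r) \<le> real (Suc n) * C * sq_norm \<mu> (D s)"
      using Suc.IH r(2) by (simp add: r_def)
    have "AE x in \<mu>. D (r + s) x = V r (D s) x + D r x"
      using V_comp[OF r(1) that(1)] op_diff[OF r(1) V_sq[OF that(1) f] f]
      by eventually_elim (simp add: D_def [abs_def] V_def [of r] right_diff_distrib)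
    then have "sq_norm \<mu> (D (r + s)) = sq_norm \<mu> (\<lambda>x. V r (D s) x + D r x)"
      using D_sq[of "r + s"] sq_integrable_add[OF V_sq[OF r(1) D_sq[OF that(1)]] D_sq[OF r(1)]] r(1) that(1)
      by (intro sq_norm_cong_AE) (auto simp: sq_integrable_def)
    also have "\<dots> \<le> sq_norm \<mu> (V r (D s)) + sq_norm \<mu> (D r)"
      by (intro sq_norm_triangle V_sq D_sq r that)
    also have "\<dots> \<le> C * sq_norm \<mu> (D s) + real (Suc n) * C * sq_norm \<mu> (D s)"
      by (intro add_mono IH VC D_sq r that)
    finally show ?case unfolding r(3) by (simp add: algebra_simps)
  qed
  have short: "AE x in \<mu>. V r f x = f x" if "0 < r" "r \<le> d" for r
  proof -
    let ?s = "\<lambda>n. r / real (Suc n)"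
    have "?s \<longlonglongrightarrow> 0" by real_asymp
    then have "filterlim ?s (at_right 0) sequentially"
      using that by (simp add: filterlim_at)
    then have "(\<lambda>n. sq_norm \<mu> (D (?s n)) / ?s n) \<longlonglongrightarrow> 0"
      by (rule filterlim_compose[OF small])
    then have "(\<lambda>n. C * r * (sq_norm \<mu> (D (?s n)) / ?s n)) \<longlonglongrightarrow> C * r * 0"
      by (rule tendsto_mult_left)
    moreover have "sq_norm \<mu> (D r) \<le> C * r * (sq_norm \<mu> (D (?s n)) / ?s n)" for n
    proof -
      have "sq_norm \<mu> (D (real (Suc n) * ?s n)) \<le> real (Suc n) * C * sq_norm \<mu> (D (?s n))"
        by (rule telescope) (use that in \<open>auto simp del: of_nat_Suc\<close>)
      then show ?thesis using that by (simp add: field_simps del: of_nat_Suc)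
    qed
    ultimately have "sq_norm \<mu> (D r) \<le> C * r * 0" by (intro LIMSEQ_le_const) auto
    then have "sq_norm \<mu> (D r) = 0" using sq_norm_nonneg[of \<mu> "D r"] by simp
    from sq_norm_eq_0[OF D_sq[OF that(1)] this] show ?thesis by (simp add: D_def)
  qed
  have iterate: "AE x in \<mu>. V (real (Suc n) * s) f x = f x" if "0 < s" "s \<le> d" for n s
  proof (induction n)
    case 0
    show ?case using short[OF that] by simp
  next
    case (Suc n)
    have r: "real (Suc n) * s > 0" using that(1) by simp
    have eqP: "P s (V (real (Suc n) * s) f) = P s f"
      by (rule op_cong_AE[OF that(1) _ _ Suc.IH])
        (use V_sq[OF r f] f in \<open>auto simp: sq_integrable_def\<close>)
    have eqt: "real (Suc (Suc n)) * s = s + real (Suc n) * s" by (simp add: algebra_simps)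
    show ?case
      unfolding eqt using V_comp[OF that(1) r] short[OF that]
      by eventually_elim (simp add: V_def [of s] eqP del: of_nat_Suc)
  qed
  obtain n where n: "t / d < real n" using reals_Archimedean2 by blast
  have "AE x in \<mu>. V (real (Suc n) * (t / real (Suc n))) f x = f x"
    by (rule iterate) (use n \<open>t > 0\<close> bound(2) in \<open>auto simp: field_simps\<close>)
  moreover have "real (Suc n) * (t / real (Suc n)) = t" by simp
  ultimately have "AE x in \<mu>. V t f x = f x" by (simp only:)
  then show ?thesis
    by eventually_elim (simp add: V_def exp_minus field_simps)
qed

end

section \<open>Dual pairs of kernel semigroups\<close>

text \<open>Positivity and the semigroup law transfer to the adjoint: pairing \<open>Q t g\<close> with its own negative
  part shows that this part vanishes, and the semigroup law is tested against indicators.\<close>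

lemma (in positive_kernel) positive_kernel_dual:
  assumes meas: "\<And>t. t > 0 \<Longrightarrow> case_prod (v t) \<in> borel_measurable (\<mu> \<Otimes>\<^sub>M \<mu>)"
    and int: "\<And>t f. t > 0 \<Longrightarrow> sq_integrable \<mu> f \<Longrightarrow> AE x in \<mu>. integrable \<mu> (\<lambda>y. v t x y * f y)"
    and sq: "\<And>t f. t > 0 \<Longrightarrow> sq_integrable \<mu> f \<Longrightarrow> sq_integrable \<mu> (kernel_op \<mu> (v t) f)"
    and dual: "\<And>t f g. t > 0 \<Longrightarrow> sq_integrable \<mu> f \<Longrightarrow> sq_integrable \<mu> g \<Longrightarrow>
      (LINT x|\<mu>. P t f x * g x) = (LINT x|\<mu>. f x * kernel_op \<mu> (v t) g x)"
    and fel: "strong_Feller \<mu> v"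
  shows "positive_kernel \<mu> v"
proof unfold_locales
  fix t g assume t: "t > (0::real)" and g: "sq_integrable \<mu> g" and g0: "AE x in \<mu>. 0 \<le> g x"
  let ?Q = "kernel_op \<mu> (v t) g"
  have Q: "sq_integrable \<mu> ?Q" by (rule sq[OF t g])
  have [measurable]: "?Q \<in> borel_measurable \<mu>" using Q by (simp add: sq_integrable_def)
  let ?w = "\<lambda>x. max 0 (- ?Q x)"
  have w: "sq_integrable \<mu> ?w" by (rule sq_integrable_dominated(1)[OF Q]) auto
  have "0 \<le> (LINT x|\<mu>. P t ?w x * g x)"
  proof (rule integral_nonneg_AE)
    have "AE x in \<mu>. 0 \<le> P t ?w x" by (intro op_nonneg t w) auto
    with g0 show "AE x in \<mu>. 0 \<le> P t ?w x * g x" by eventually_elim simp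
  qed
  also have "\<dots> = (LINT x|\<mu>. ?w x * ?Q x)" by (rule dual[OF t w g])
  also have "\<dots> = (LINT x|\<mu>. - (?w x)\<^sup>2)"
    by (rule Bochner_Integration.integral_cong) (auto simp: power2_eq_square max_def)
  also have "\<dots> = - (sq_norm \<mu> ?w)\<^sup>2" by (simp add: sq_norm_power2)
  finally have "sq_norm \<mu> ?w = 0" by simp
  from sq_norm_eq_0[OF w this] show "AE x in \<mu>. 0 \<le> ?Q x" by eventually_elim simp
next
  fix s t f assume s: "s > (0::real)" and t: "t > (0::real)" and f: "sq_integrable \<mu> f"
  let ?Q = "\<lambda>t. kernel_op \<mu> (v t)"
  show "AE x in \<mu>. ?Q (s + t) f x = ?Q s (?Q t f) x"
  proof (rule AE_eq_by_testing)
    show "sq_integrable \<mu> (?Q (s + t) f)" "sq_integrable \<mu> (?Q s (?Q t f))"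
      using s t f by (auto intro!: sq)
    fix A assume "A \<in> sets \<mu>" "emeasure \<mu> A < \<infinity>"
    then have A: "sq_integrable \<mu> (indicator A)" by (rule sq_integrable_indicator)
    have Ps: "sq_integrable \<mu> (P s (indicator A))" by (rule op_sq[OF s A])
    have "(LINT x|\<mu>. ?Q (s + t) f x * indicator A x) = (LINT x|\<mu>. P (t + s) (indicator A) x * f x)"
      using dual[OF _ A f, of "s + t"] s t by (simp add: mult.commute add.commute)
    also have "\<dots> = (LINT x|\<mu>. P t (P s (indicator A)) x * f x)"
    proof (rule integral_cong_AE)
      show "AE x in \<mu>. P (t + s) (indicator A) x * f x = P t (P s (indicator A)) x * f x"
        using op_semigroup[OF t s A] by eventually_elim simp
    qed (use op_sq[OF _ A, of "t + s"] op_sq[OF t Ps] f s t in \<open>auto simp: sq_integrable_def\<close>)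
    also have "\<dots> = (LINT x|\<mu>. P s (indicator A) x * ?Q t f x)" by (rule dual[OF t Ps f])
    also have "\<dots> = (LINT x|\<mu>. indicator A x * ?Q s (?Q t f) x)" by (rule dual[OF s A sq[OF t f]])
    finally show "(LINT x|\<mu>. ?Q (s + t) f x * indicator A x) = (LINT x|\<mu>. ?Q s (?Q t f) x * indicator A x)"
      by (simp add: mult.commute)
  qed
qed (fact sets_borel support meas int sq fel)+

locale dual_kernels =
  fwd: positive_kernel \<mu> u + bwd: positive_kernel \<mu> v
  for \<mu> :: "'a::polish_space measure" and u v :: "real \<Rightarrow> 'a \<Rightarrow> 'a \<Rightarrow> real" +
  assumes duality: "t > 0 \<Longrightarrow> sq_integrable \<mu> f \<Longrightarrow> sq_integrable \<mu> g \<Longrightarrow>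
    (LINT x|\<mu>. kernel_op \<mu> (u t) f x * g x) = (LINT x|\<mu>. f x * kernel_op \<mu> (v t) g x)"
begin

abbreviation P :: "real \<Rightarrow> ('a \<Rightarrow> real) \<Rightarrow> 'a \<Rightarrow> real" where "P t \<equiv> kernel_op \<mu> (u t)"
abbreviation Q :: "real \<Rightarrow> ('a \<Rightarrow> real) \<Rightarrow> 'a \<Rightarrow> real" where "Q t \<equiv> kernel_op \<mu> (v t)"

text \<open>The \<open>C\<^sup>*\<close>-identity argument: \<open>\<parallel>Q g\<parallel>\<^sup>2\<close> is the pairing of \<open>P (Q g)\<close> with \<open>g\<close>.\<close>

lemma dual_norm_bound:
  assumes t: "t > 0" and B: "\<And>f. sq_integrable \<mu> f \<Longrightarrow> sq_norm \<mu> (P t f) \<le> B * sq_norm \<mu> f"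
    and g: "sq_integrable \<mu> g"
  shows "sq_norm \<mu> (Q t g) \<le> B * sq_norm \<mu> g"
proof -
  let ?n = "sq_norm \<mu> (Q t g)"
  have Qg: "sq_integrable \<mu> (Q t g)" by (rule bwd.op_sq[OF t g])
  have "?n * ?n = (LINT x|\<mu>. Q t g x * Q t g x)"
    using sq_norm_power2[of \<mu> "Q t g"] by (simp add: power2_eq_square)
  also have "\<dots> = (LINT x|\<mu>. P t (Q t g) x * g x)"
    using duality[OF t Qg g] by simp
  also have "\<dots> \<le> sq_norm \<mu> (P t (Q t g)) * sq_norm \<mu> g"
    using sq_Cauchy_Schwarz[OF fwd.op_sq[OF t Qg] g] by simp
  also have "\<dots> \<le> B * ?n * sq_norm \<mu> g"
    by (rule mult_right_mono[OF B[OF Qg] sq_norm_nonneg])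
  finally have le: "?n * ?n \<le> (B * sq_norm \<mu> g) * ?n" by (simp add: mult_ac)
  show ?thesis
  proof (cases "?n = 0")
    case True
    have "0 \<le> B * sq_norm \<mu> g"
      using B[OF g] sq_norm_nonneg[of \<mu> "P t g"] by linarith
    with True show ?thesis by simp
  next
    case False
    then have "?n > 0" using sq_norm_nonneg[of \<mu> "Q t g"] by linarith
    with le show ?thesis by (simp add: mult_le_cancel_right)
  qed
qed

end

text \<open>Everything about the two semigroups and their ground states that the argument below uses, in a
  form invariant under exchanging \<open>(u, \<phi>)\<close> and \<open>(v, \<psi>)\<close>. The conclusion of \<open>improving\<close> is stated as a
  pairing because this form is self-dual.\<close>

locale ground_state_pair = dual_kernels \<mu> u v
  for \<mu> :: "'a::polish_space measure" and u v :: "real \<Rightarrow> 'a \<Rightarrow> 'a \<Rightarrow> real" +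
  fixes \<phi> \<psi> :: "'a \<Rightarrow> real" and l t0 :: real
  assumes t0: "t0 > 0"
    and improving: "sq_integrable \<mu> f \<Longrightarrow> sq_integrable \<mu> g \<Longrightarrow> AE x in \<mu>. 0 \<le> f x \<Longrightarrow>
      AE x in \<mu>. 0 \<le> g x \<Longrightarrow> \<not> (AE x in \<mu>. f x = 0) \<Longrightarrow> \<not> (AE x in \<mu>. g x = 0) \<Longrightarrow>
      0 < (LINT x|\<mu>. kernel_op \<mu> (u t0) f x * g x)"
    and smoothing_u: "\<exists>C. \<forall>f. sq_integrable \<mu> f \<longrightarrow> (AE x in \<mu>. \<bar>kernel_op \<mu> (u t0) f x\<bar> \<le> C * sq_norm \<mu> f)"
    and smoothing_v: "\<exists>C. \<forall>f. sq_integrable \<mu> f \<longrightarrow> (AE x in \<mu>. \<bar>kernel_op \<mu> (v t0) f x\<bar> \<le> C * sq_norm \<mu> f)"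
    and \<phi>: "sq_integrable \<mu> \<phi>" "continuous_on UNIV \<phi>" "bounded (range \<phi>)" "AE x in \<mu>. 0 < \<phi> x"
    and \<psi>: "sq_integrable \<mu> \<psi>" "continuous_on UNIV \<psi>" "bounded (range \<psi>)" "AE x in \<mu>. 0 < \<psi> x"
    and eigen_\<phi>: "t > 0 \<Longrightarrow> AE x in \<mu>. kernel_op \<mu> (u t) \<phi> x = exp (- l * t) * \<phi> x"
    and eigen_\<psi>: "t > 0 \<Longrightarrow> AE x in \<mu>. kernel_op \<mu> (v t) \<psi> x = exp (- l * t) * \<psi> x"
    and pGSD_u: "pGSD \<mu> u l \<phi>" and pGSD_v: "pGSD \<mu> v l \<psi>"
    and mass_u: "\<exists>C T. \<forall>t\<ge>T. \<forall>x. exp (l * t) * Feller_op \<mu> u t (\<lambda>_. 1) x \<le> C"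
    and mass_v: "\<exists>C T. \<forall>t\<ge>T. \<forall>x. exp (l * t) * Feller_op \<mu> v t (\<lambda>_. 1) x \<le> C"
begin

lemma swap: "ground_state_pair \<mu> v u \<psi> \<phi> l t0"
proof (intro ground_state_pair.intro dual_kernels.intro ground_state_pair_axioms.intro
    dual_kernels_axioms.intro)
  show "positive_kernel \<mu> v" "positive_kernel \<mu> u"
    by (rule bwd.positive_kernel_axioms, rule fwd.positive_kernel_axioms)
  show dual: "(LINT x|\<mu>. kernel_op \<mu> (v t) f x * g x) = (LINT x|\<mu>. f x * kernel_op \<mu> (u t) g x)"
    if "t > 0" "sq_integrable \<mu> f" "sq_integrable \<mu> g" for t f g
    using duality[OF that(1,3,2)] by (simp add: mult.commute)
  show "0 < (LINT x|\<mu>. kernel_op \<mu> (v t0) f x * g x)"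
    if "sq_integrable \<mu> f" "sq_integrable \<mu> g" "AE x in \<mu>. 0 \<le> f x" "AE x in \<mu>. 0 \<le> g x"
      "\<not> (AE x in \<mu>. f x = 0)" "\<not> (AE x in \<mu>. g x = 0)" for f g
    using improving[OF that(2,1,4,3,6,5)] dual[OF t0 that(1,2)] by (simp add: mult.commute)
qed (fact t0 smoothing_u smoothing_v \<phi> \<psi> eigen_\<phi> eigen_\<psi> pGSD_u pGSD_v mass_u mass_v)+

lemma \<phi>_nonneg: "0 \<le> \<phi> x"
proof (rule fwd.continuous_AE_le[of "\<lambda>_. 0"])
  show "AE x in \<mu>. 0 \<le> \<phi> x" using \<phi>(4) by eventually_elim simp
qed (simp_all add: \<phi>(2))

lemma \<psi>_nonneg: "0 \<le> \<psi> x"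
proof (rule fwd.continuous_AE_le[of "\<lambda>_. 0"])
  show "AE x in \<mu>. 0 \<le> \<psi> x" using \<psi>(4) by eventually_elim simp
qed (simp_all add: \<psi>(2))

lemma measurable_ground_states [measurable]: "\<phi> \<in> borel_measurable \<mu>" "\<psi> \<in> borel_measurable \<mu>"
  using \<phi>(1) \<psi>(1) by (auto simp: sq_integrable_def)

lemma \<phi>_Linf: "\<phi> \<in> Linf \<mu>"
proof -
  obtain c where "\<And>x. \<bar>\<phi> x\<bar> \<le> c" using \<phi>(3) by (auto simp: bounded_iff)
  then show ?thesis by (auto simp: Linf_def)
qed

section \<open>Integrability of the ground states\<close>

text \<open>The domination hypothesis for the adjoint semigroup controls \<open>\<phi>\<close>, the ground state of the
  other one, through \<open>\<integral>\<^sub>A \<phi> = \<integral> h n \<cdot> \<phi>\<close> with \<open>h n = exp (l * t n) Q (t n) 1\<^sub>A\<close>. The norm of \<open>h n\<close> is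
  bounded uniformly in \<open>n\<close> because its square is \<open>exp (l * t n)\<close> times the integral of
  \<open>P (t n) (h n)\<close> over \<open>A\<close>, and \<open>h n\<close> is bounded by a constant.\<close>

lemma \<phi>_integrable: "integrable \<mu> \<phi>"
proof -
  obtain C t1 K where C: "C > 0" and t1: "t1 > 0" and K: "exhausting_family t1 K"
    and dom: "\<And>t x. t \<ge> t1 \<Longrightarrow> indicator (K t) x * bwd.T t (\<lambda>_. 1) x \<le> C * exp (- l * t) * \<psi> x"
    using pGSD_v unfolding pGSD_def by blast
  obtain C1 T1 where C1: "\<And>t x. t \<ge> T1 \<Longrightarrow> exp (l * t) * fwd.T t (\<lambda>_. 1) x \<le> C1"
    using mass_u by blast
  obtain C2 T2 where C2: "\<And>t x. t \<ge> T2 \<Longrightarrow> exp (l * t) * bwd.T t (\<lambda>_. 1) x \<le> C2"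
    using mass_v by blast
  define c where "c = max 0 (max C1 C2)"
  have c: "c \<ge> 0" "C1 \<le> c" "C2 \<le> c" by (simp_all add: c_def)
  obtain k :: nat where k: "max t1 (max T1 T2) \<le> real k" using real_arch_simple by blast
  define t where "t n = real (n + k)" for n
  have t: "t n > 0" "t n \<ge> t1" "t n \<ge> T1" "t n \<ge> T2" for n
    using k t1 by (auto simp: t_def)
  have K_meas [measurable]: "K (t n) \<in> sets \<mu>" for n
  proof -
    have "compact (K (t n))" using K t(2)[of n] by (simp add: exhausting_family_def)
    then show ?thesis by (simp add: fwd.sets_borel compact_imp_closed borel_closed)
  qed
  have K_ev: "\<forall>\<^sub>F n in sequentially. x \<in> K (t n)" for x
  proof -
    have "x \<in> (\<Union>s\<in>{t1..}. K s)" using K by (simp add: exhausting_family_def)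
    then obtain s where s: "s \<ge> t1" "x \<in> K s" by auto
    obtain m :: nat where m: "s < real m" using reals_Archimedean2 by blast
    have "x \<in> K (t n)" if "n \<ge> m" for n
    proof -
      have "s < t n" using m that by (simp add: t_def)
      then show ?thesis using s K by (auto simp: exhausting_family_def)
    qed
    then show ?thesis by (auto simp: eventually_sequentially)
  qed
  \<comment> \<open>The part of \<open>\<phi>\<close> outside the exhausting sets is small in \<open>L\<^sup>2\<close>.\<close>
  define r where "r n x = \<phi> x * indicator (- K (t n)) x" for n x
  have r_sq: "sq_integrable \<mu> (r n)" for n
    unfolding r_def by (intro sq_integrable_cut \<phi>) (use sets.compl_sets[OF K_meas] in \<open>simp add: fwd.space_UNIV Compl_eq_Diff_UNIV\<close>)
  have [measurable]: "r n \<in> borel_measurable \<mu>" for n using r_sq by (simp add: sq_integrable_def)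
  have "(\<lambda>n. LINT x|\<mu>. (r n x)\<^sup>2) \<longlonglongrightarrow> (LINT x|\<mu>. 0)"
  proof (rule integral_dominated_convergence[where w="\<lambda>x. (\<phi> x)\<^sup>2"])
    show "AE x in \<mu>. (\<lambda>n. (r n x)\<^sup>2) \<longlonglongrightarrow> 0"
    proof (intro AE_I2 tendsto_eventually)
      fix x show "\<forall>\<^sub>F n in sequentially. (r n x)\<^sup>2 = 0"
        using K_ev[of x] by eventually_elim (simp add: r_def)
    qed
  qed (use \<phi>(1) in \<open>auto simp: sq_integrable_def r_def split: split_indicator\<close>)
  then have r_lim: "(\<lambda>n. sq_norm \<mu> (r n)) \<longlonglongrightarrow> 0"
    unfolding sq_norm_def using tendsto_real_sqrt by fastforce
  define I where "I = C * (LINT x|\<mu>. \<psi> x * \<phi> x)"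
  have psiphi: "integrable \<mu> (\<lambda>x. \<psi> x * \<phi> x)" by (rule sq_integrable_mult[OF \<psi>(1) \<phi>(1)])
  have bound: "(LINT x|\<mu>. \<phi> x * indicator A x) \<le> I" if A: "A \<in> sets \<mu>" "emeasure \<mu> A < \<infinity>" for A
  proof -
    have [measurable]: "A \<in> sets \<mu>" by (rule A)
    have ind: "sq_integrable \<mu> (indicator A)" by (rule sq_integrable_indicator[OF A])
    define h where "h n x = exp (l * t n) * Q (t n) (indicator A) x" for n x
    have h_sq: "sq_integrable \<mu> (h n)" for n
      unfolding h_def by (intro sq_integrable_scale bwd.op_sq t ind)
    have h_meas [measurable]: "h n \<in> borel_measurable \<mu>" for n using h_sq by (simp add: sq_integrable_def)
    have h_basic: "AE x in \<mu>. 0 \<le> h n x \<and> h n x \<le> exp (l * t n) * bwd.T (t n) (\<lambda>_. 1) x" for n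
    proof -
      have "AE x in \<mu>. 0 \<le> Q (t n) (indicator A) x"
        by (intro bwd.op_nonneg t ind) simp
      moreover have "AE x in \<mu>. Q (t n) (indicator A) x \<le> Q (t n) (\<lambda>_. 1) x"
        by (intro bwd.Linf_op_mono t bwd.Linf_const bwd.Linf_indicator A) (auto simp: indicator_def)
      moreover note bwd.T_spec(2)[OF t(1)[of n] bwd.Linf_const[of 1]]
      ultimately show ?thesis
        by eventually_elim (simp add: h_def)
    qed
    have h_le: "AE x in \<mu>. \<bar>h n x\<bar> \<le> c" for n
      using h_basic[of n]
    proof eventually_elim
      case (elim x)
      then show ?case using C2[OF t(4)[of n], of x] c by linarith
    qed
    have h_dom: "AE x in \<mu>. h n x * \<phi> x \<le> C * (\<psi> x * \<phi> x) + h n x * r n x" for n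
      using h_basic[of n]
    proof eventually_elim
      case (elim x)
      show ?case
      proof (cases "x \<in> K (t n)")
        case True
        then have "bwd.T (t n) (\<lambda>_. 1) x \<le> C * exp (- l * t n) * \<psi> x"
          using dom[OF t(2)[of n], of x] by simp
        then have "exp (l * t n) * bwd.T (t n) (\<lambda>_. 1) x \<le> exp (l * t n) * (C * exp (- l * t n) * \<psi> x)"
          by (intro mult_left_mono) auto
        also have "\<dots> = C * \<psi> x" by (simp add: exp_minus)
        finally have "h n x \<le> C * \<psi> x" using elim by linarith
        then have "h n x * \<phi> x \<le> C * \<psi> x * \<phi> x" by (intro mult_right_mono \<phi>_nonneg)
        with True show ?thesis by (simp add: r_def mult.assoc)
      next
        case False
        then show ?thesis using C \<phi>_nonneg[of x] \<psi>_nonneg[of x] by (simp add: r_def)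
      qed
    qed
    define M where "M = c * sqrt (measure \<mu> A)"
    have h_norm: "sq_norm \<mu> (h n) \<le> M" for n
    proof -
      have "(sq_norm \<mu> (h n))\<^sup>2 = (LINT x|\<mu>. h n x * h n x)"
        unfolding sq_norm_power2 by (simp add: power2_eq_square)
      also have "\<dots> = exp (l * t n) * (LINT x|\<mu>. h n x * Q (t n) (indicator A) x)"
        by (simp add: h_def mult_ac)
      also have "\<dots> = (LINT x|\<mu>. (exp (l * t n) * P (t n) (h n) x) * indicator A x)"
        using duality[OF t(1)[of n] h_sq[of n] ind] by (simp add: mult.assoc)
      also have "\<dots> \<le> (LINT x|\<mu>. c\<^sup>2 * indicator A x)"
      proof (rule integral_mono_AE)
        show "integrable \<mu> (\<lambda>x. (exp (l * t n) * P (t n) (h n) x) * indicator A x)"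
          by (intro sq_integrable_mult sq_integrable_scale fwd.op_sq t h_sq ind)
        show "integrable \<mu> (\<lambda>x. c\<^sup>2 * indicator A x :: real)"
          using A by (intro integrable_mult_right) (simp add: integrable_indicator_iff)
        show "AE x in \<mu>. (exp (l * t n) * P (t n) (h n) x) * indicator A x \<le> c\<^sup>2 * indicator A x"
          using fwd.Linf_op_bound[OF t(1)[of n] h_meas[of n] h_le[of n]] fwd.T_spec(2)[OF t(1)[of n] fwd.Linf_const[of 1]]
        proof eventually_elim
          case (elim x)
          have "exp (l * t n) * P (t n) (h n) x \<le> exp (l * t n) * (c * fwd.T (t n) (\<lambda>_. 1) x)"
            using elim by (intro mult_left_mono) auto
          also have "\<dots> = c * (exp (l * t n) * fwd.T (t n) (\<lambda>_. 1) x)" by simp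
          also have "\<dots> \<le> c * c"
            using order_trans[OF C1[OF t(3)[of n], of x] c(2)] c(1) by (rule mult_left_mono)
          finally show ?case by (simp add: power2_eq_square split: split_indicator)
        qed
      qed
      also have "\<dots> = c\<^sup>2 * measure \<mu> A" using A by (simp add: fwd.space_UNIV)
      also have "\<dots> = M\<^sup>2" by (simp add: M_def power_mult_distrib)
      finally show ?thesis by (rule power2_le_imp_le) (simp add: M_def c(1))
    qed
    have "(LINT x|\<mu>. \<phi> x * indicator A x) \<le> I + M * sq_norm \<mu> (r n)" for n
    proof -
      have "(LINT x|\<mu>. \<phi> x * indicator A x) =
          exp (l * t n) * (LINT x|\<mu>. exp (- l * t n) * \<phi> x * indicator A x)"
        by (simp add: mult.assoc exp_minus)
      also have "(LINT x|\<mu>. exp (- l * t n) * \<phi> x * indicator A x) =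
          (LINT x|\<mu>. P (t n) \<phi> x * indicator A x)"
        by (rule integral_cong_AE)
          (use eigen_\<phi>[OF t(1)[of n]] fwd.op_measurable[OF t(1)[of n]] in \<open>auto elim: eventually_mono\<close>)
      also have "exp (l * t n) * \<dots> = (LINT x|\<mu>. h n x * \<phi> x)"
        using duality[OF t(1)[of n] \<phi>(1) ind] unfolding h_def mult.assoc by (simp add: mult.commute)
      also have "\<dots> \<le> (LINT x|\<mu>. C * (\<psi> x * \<phi> x) + h n x * r n x)"
        by (intro integral_mono_AE sq_integrable_mult h_sq \<phi>(1) h_dom
            Bochner_Integration.integrable_add integrable_mult_right psiphi r_sq)
      also have "\<dots> = I + (LINT x|\<mu>. h n x * r n x)"
        by (subst Bochner_Integration.integral_add)
          (auto simp: I_def intro!: psiphi sq_integrable_mult h_sq r_sq)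
      also have "(LINT x|\<mu>. h n x * r n x) \<le> sq_norm \<mu> (h n) * sq_norm \<mu> (r n)"
        using sq_Cauchy_Schwarz[OF h_sq[of n] r_sq[of n]] by simp
      also have "\<dots> \<le> M * sq_norm \<mu> (r n)"
        by (intro mult_right_mono h_norm sq_norm_nonneg)
      finally show ?thesis by simp
    qed
    moreover have "(\<lambda>n. I + M * sq_norm \<mu> (r n)) \<longlonglongrightarrow> I + M * 0"
      by (intro tendsto_intros r_lim)
    ultimately show ?thesis by (intro LIMSEQ_le_const[where X="\<lambda>n. I + M * sq_norm \<mu> (r n)"]) auto
  qed
  show ?thesis
  proof (rule integrable_of_bounded_exhaustion[where A=fwd.E and c=I])
    show "integrable \<mu> (\<lambda>x. \<phi> x * indicator (fwd.E n) x)" for n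
      by (intro sq_integrable_mult \<phi> sq_integrable_indicator fwd.E_sets fwd.E_finite)
    show "(LINT x|\<mu>. \<phi> x * indicator (fwd.E n) x) \<le> I" for n
      by (intro bound fwd.E_sets fwd.E_finite)
  qed (use fwd.E_spec \<phi>_nonneg in auto)
qed

lemma \<psi>_integrable: "integrable \<mu> \<psi>"
  by (rule ground_state_pair.\<phi>_integrable[OF swap])

text \<open>Duality in \<open>L\<^sup>2\<close> gives the identity for the truncations of \<open>f\<close>; integrability of \<open>\<psi>\<close> makes
  dominated convergence available on both sides.\<close>

lemma \<psi>_eigenfunctional:
  assumes t: "t > 0" and f: "f \<in> Linf \<mu>"
  shows "(LINT x|\<mu>. \<psi> x * P t f x) = exp (- l * t) * (LINT x|\<mu>. \<psi> x * f x)"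
proof (rule LIMSEQ_unique)
  let ?f = "\<lambda>n x. f x * indicator (fwd.E n) x"
  show "(\<lambda>n. LINT x|\<mu>. \<psi> x * P t (?f n) x) \<longlonglongrightarrow> (LINT x|\<mu>. \<psi> x * P t f x)"
    by (rule fwd.integral_op_cut_tendsto[OF t \<psi>_integrable f])
  have [measurable]: "f \<in> borel_measurable \<mu>" by (rule fwd.Linf_measurable[OF f])
  have "(LINT x|\<mu>. \<psi> x * P t (?f n) x) = exp (- l * t) * (LINT x|\<mu>. \<psi> x * ?f n x)" for n
  proof -
    have "(LINT x|\<mu>. \<psi> x * P t (?f n) x) = (LINT x|\<mu>. ?f n x * Q t \<psi> x)"
      using duality[OF t fwd.Linf_cut_sq[OF f, of n] \<psi>(1)] by (simp add: mult.commute)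
    also have "\<dots> = (LINT x|\<mu>. exp (- l * t) * (\<psi> x * ?f n x))"
    proof (rule integral_cong_AE)
      show "AE x in \<mu>. ?f n x * Q t \<psi> x = exp (- l * t) * (\<psi> x * ?f n x)"
        using eigen_\<psi>[OF t] by eventually_elim simp
    qed (use bwd.op_measurable[OF t] in auto)
    finally show ?thesis by simp
  qed
  then show "(\<lambda>n. LINT x|\<mu>. \<psi> x * P t (?f n) x) \<longlonglongrightarrow> exp (- l * t) * (LINT x|\<mu>. \<psi> x * f x)"
    by (simp only:) (intro tendsto_mult_left fwd.integral_cut_tendsto \<psi>_integrable f)
qed

section \<open>Quasi-stationarity of the normalized ground state\<close>

definition Z :: real where "Z = (LINT x|\<mu>. \<psi> x)"

lemma Z_pos: "Z > 0"
proof -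
  have "Z \<noteq> 0"
  proof
    assume "Z = 0"
    then have "AE x in \<mu>. \<psi> x = 0"
      using integral_nonneg_eq_0_iff_AE[OF \<psi>_integrable] \<psi>_nonneg by (simp add: Z_def)
    with \<psi>(4) have "AE x in \<mu>. False" by eventually_elim simp
    then show False using fwd.not_AE_False by simp
  qed
  moreover have "Z \<ge> 0" unfolding Z_def by (intro integral_nonneg_AE AE_I2 \<psi>_nonneg)
  ultimately show ?thesis by simp
qed

abbreviation m :: "'a measure" where "m \<equiv> normalized_measure \<mu> \<psi>"

lemma sets_m: "sets m = sets \<mu>"
  by (simp add: normalized_measure_def)

lemma prob_space_m: "prob_space m"
proof
  have "emeasure m (space m) = (\<integral>\<^sup>+x. ennreal (\<psi> x / Z) \<partial>\<mu>)"
    by (simp add: normalized_measure_def emeasure_density Z_def cong: nn_integral_cong)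
  also have "\<dots> = ennreal (LINT x|\<mu>. \<psi> x / Z)"
    using Z_pos by (intro nn_integral_eq_integral AE_I2 integrable_divide \<psi>_integrable) (simp add: \<psi>_nonneg)
  also have "\<dots> = 1" using Z_pos by (simp add: Z_def)
  finally show "emeasure m (space m) = 1" .
qed

lemma integral_m:
  assumes "g \<in> borel_measurable \<mu>" shows "(LINT x|m. g x) = (LINT x|\<mu>. \<psi> x * g x) / Z"
proof -
  have "(LINT x|m. g x) = (LINT x|\<mu>. (\<psi> x / Z) *\<^sub>R g x)"
    unfolding normalized_measure_def Z_def[symmetric]
    by (rule integral_density) (use assms Z_pos \<psi>_nonneg in auto)
  then show ?thesis by (simp add: field_simps)
qed

lemma quasi_stationary_m: "quasi_stationary \<mu> u m"
proof -
  have T: "(LINT x|m. fwd.T t f x) = exp (- l * t) * (LINT x|m. f x)" if t: "t > 0" and f: "f \<in> Linf \<mu>" for t f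
  proof -
    have "(LINT x|\<mu>. \<psi> x * fwd.T t f x) = (LINT x|\<mu>. \<psi> x * P t f x)"
    proof (rule integral_cong_AE)
      show "AE x in \<mu>. \<psi> x * fwd.T t f x = \<psi> x * P t f x"
        using fwd.T_spec(2)[OF t f] by eventually_elim simp
    qed (use fwd.op_measurable[OF t] fwd.T_measurable[OF t f] fwd.Linf_measurable[OF f] in auto)
    then show ?thesis
      using \<psi>_eigenfunctional[OF t f] fwd.T_measurable[OF t f] fwd.Linf_measurable[OF f]
      by (simp add: integral_m)
  qed
  have one: "(LINT x|m. 1) = (1::real)"
    using prob_space.prob_space[OF prob_space_m] by simp
  show ?thesis
    unfolding quasi_stationary_def
    using prob_space_m sets_m fwd.sets_borel T fwd.Linf_const[of 1] one by auto
qed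

lemma AE_m: assumes "AE x in \<mu>. R x" shows "AE x in m. R x"
  unfolding normalized_measure_def
  by (subst AE_density) (use assms in \<open>auto elim: eventually_mono\<close>)

section \<open>Simplicity of the eigenvalue and uniqueness\<close>

text \<open>Subtract the multiple
 of \<open>\<psi>\<close> that makes the difference \<open>h\<close> orthogonal to \<open>\<phi>\<close>. Then
  \<open>\<bar>h\<bar> \<le> exp (l * t0) Q \<bar>h\<bar>\<close>, and since both sides have the same pairing with \<open>\<phi> > 0\<close> they are equal.
  So the positive and negative parts \<open>p\<close>, \<open>q\<close> of \<open>h\<close> are eigenfunctions too. They have disjoint
  supports, so positivity improvement forces one of them to vanish, and then the orthogonality to
  \<open>\<phi>\<close> leaves only \<open>h = 0\<close>.\<close>

lemma \<psi>_simple: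
  assumes \<rho>: "sq_integrable \<mu> \<rho>" and eigen: "AE x in \<mu>. Q t0 \<rho> x = exp (- l * t0) * \<rho> x"
  shows "\<exists>c. AE x in \<mu>. \<rho> x = c * \<psi> x"
proof -
  let ?e = "exp (- l * t0)"
  define I where "I f = (LINT x|\<mu>. f x * \<phi> x)" for f
  have I_int: "integrable \<mu> (\<lambda>x. f x * \<phi> x)" if "sq_integrable \<mu> f" for f
    by (rule sq_integrable_mult[OF that \<phi>(1)])
  have I_zero: "AE x in \<mu>. f x = 0" if f: "sq_integrable \<mu> f" "AE x in \<mu>. 0 \<le> f x" "I f = 0" for f
  proof -
    have "AE x in \<mu>. 0 \<le> f x * \<phi> x"
      using f(2) by eventually_elim (simp add: \<phi>_nonneg)
    then have "AE x in \<mu>. f x * \<phi> x = 0"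
      using integral_nonneg_eq_0_iff_AE[OF I_int[OF f(1)]] f(3) by (simp add: I_def)
    with \<phi>(4) show ?thesis by eventually_elim simp
  qed
  have "I \<psi> \<noteq> 0"
  proof
    assume "I \<psi> = 0"
    then have "AE x in \<mu>. \<psi> x = 0" by (intro I_zero \<psi>) (auto simp: \<psi>_nonneg)
    with \<psi>(4) have "AE x in \<mu>. False" by eventually_elim simp
    then show False using fwd.not_AE_False by simp
  qed
  define c where "c = I \<rho> / I \<psi>"
  define h where "h x = \<rho> x - c * \<psi> x" for x
  have c\<psi>: "sq_integrable \<mu> (\<lambda>x. c * \<psi> x)" by (rule sq_integrable_scale[OF \<psi>(1)])
  have h: "sq_integrable \<mu> h" unfolding h_def by (rule sq_integrable_diff[OF \<rho> c\<psi>])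
  have [measurable]: "h \<in> borel_measurable \<mu>" using h by (simp add: sq_integrable_def)
  have "I h = I \<rho> - c * I \<psi>"
    using I_int[OF \<rho>] I_int[OF \<psi>(1)] by (simp add: I_def h_def left_diff_distrib mult.assoc)
  then have Ih: "I h = 0" using \<open>I \<psi> \<noteq> 0\<close> by (simp add: c_def)
  have Qh: "AE x in \<mu>. Q t0 h x = ?e * h x"
    using bwd.op_diff[OF t0 \<rho> c\<psi>] eigen eigen_\<psi>[OF t0]
    by eventually_elim (simp add: h_def [abs_def] bwd.op_scale right_diff_distrib)
  \<comment> \<open>Pairing with \<open>\<phi>\<close> turns the pointwise inequality for \<open>\<bar>h\<bar>\<close> into an equality.\<close>
  let ?a = "\<lambda>x. \<bar>h x\<bar>"
  have a: "sq_integrable \<mu> ?a" by (rule sq_integrable_abs[OF h])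
  have Qa: "AE x in \<mu>. Q t0 ?a x = ?e * ?a x"
  proof -
    let ?k = "\<lambda>x. Q t0 ?a x - ?e * ?a x"
    have Qa_sq: "sq_integrable \<mu> (Q t0 ?a)" by (rule bwd.op_sq[OF t0 a])
    have ea: "sq_integrable \<mu> (\<lambda>x. ?e * ?a x)" by (rule sq_integrable_scale[OF a])
    have "AE x in \<mu>. 0 \<le> ?k x"
      using bwd.op_abs[OF t0 h] Qh by eventually_elim (simp add: abs_mult)
    moreover have "I ?k = 0"
    proof -
      have "I (Q t0 ?a) = (LINT x|\<mu>. P t0 \<phi> x * ?a x)"
        using duality[OF t0 \<phi>(1) a] by (simp add: I_def mult.commute)
      also have "\<dots> = (LINT x|\<mu>. ?e * (?a x * \<phi> x))"
      proof (rule integral_cong_AE)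
        show "AE x in \<mu>. P t0 \<phi> x * ?a x = ?e * (?a x * \<phi> x)"
          using eigen_\<phi>[OF t0] by eventually_elim simp
      qed (use fwd.op_measurable[OF t0] in auto)
      also have "\<dots> = I (\<lambda>x. ?e * ?a x)" by (simp add: I_def mult.assoc)
      finally show ?thesis
        using I_int[OF Qa_sq] I_int[OF ea] by (simp add: I_def left_diff_distrib)
    qed
    ultimately have "AE x in \<mu>. ?k x = 0" by (intro I_zero sq_integrable_diff Qa_sq ea)
    then show ?thesis by eventually_elim simp
  qed
  define p where "p x = (1/2) * (?a x + h x)" for x
  define q where "q x = (1/2) * (?a x - h x)" for x
  have p: "sq_integrable \<mu> p" and q: "sq_integrable \<mu> q"
    unfolding p_def q_def by (intro sq_integrable_scale sq_integrable_add sq_integrable_diff a h)+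
  have q_half: "Q t0 q = (\<lambda>x. (1/2) * Q t0 (\<lambda>y. ?a y - h y) x)"
    unfolding q_def [abs_def] by (rule bwd.op_scale)
  have Qq: "AE x in \<mu>. Q t0 q x = ?e * q x"
    using bwd.op_diff[OF t0 a h] Qa Qh
    by eventually_elim (simp add: q_half, simp add: q_def algebra_simps)
  have pq: "p x * q x = 0" for x by (simp add: p_def q_def abs_if)
  have pq0: "0 \<le> p x" "0 \<le> q x" for x by (auto simp: p_def q_def)
  have h_eq: "h x = p x - q x" for x by (simp add: p_def q_def field_simps)
  have "(AE x in \<mu>. p x = 0) \<or> (AE x in \<mu>. q x = 0)"
  proof (rule ccontr)
    assume "\<not> ?thesis"
    then have "0 < (LINT x|\<mu>. P t0 p x * q x)"
      by (intro improving p q) (auto simp: pq0)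
    also have "\<dots> = (LINT x|\<mu>. p x * Q t0 q x)" by (rule duality[OF t0 p q])
    also have "\<dots> = (LINT x|\<mu>. 0)"
    proof (rule integral_cong_AE)
      show "AE x in \<mu>. p x * Q t0 q x = 0"
        using Qq by eventually_elim (use pq in \<open>simp add: mult.left_commute\<close>)
    qed (use p q bwd.op_sq[OF t0 q] in \<open>auto simp: sq_integrable_def\<close>)
    finally show False by simp
  qed
  then have "AE x in \<mu>. h x = 0"
  proof
    assume p0: "AE x in \<mu>. p x = 0"
    have "AE x in \<mu>. -1 * h x = 0"
    proof (intro I_zero sq_integrable_scale h)
      show "AE x in \<mu>. 0 \<le> -1 * h x" using p0 by eventually_elim (simp add: h_eq pq0)
      show "I (\<lambda>x. -1 * h x) = 0" using Ih by (simp add: I_def)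
    qed
    then show ?thesis by eventually_elim simp
  next
    assume q0: "AE x in \<mu>. q x = 0"
    show ?thesis
    proof (intro I_zero h Ih)
      show "AE x in \<mu>. 0 \<le> h x" using q0 by eventually_elim (simp add: h_eq pq0)
    qed
  qed
  then have "AE x in \<mu>. \<rho> x = c * \<psi> x" by eventually_elim (simp add: h_def)
  then show ?thesis ..
qed

text \<open>The density of a quasi-stationary measure is shown to be a square-integrable eigenfunction of
  \<open>Q t0\<close>, to which simplicity applies; a single time \<open>t0\<close> suffices.\<close>

lemma quasi_stationary_unique:
  assumes qs: "quasi_stationary \<mu> u \<nu>" shows "\<nu> = m"
proof -
  let ?e = "exp (- l * t0)"
  let ?c = "LINT x|\<nu>. fwd.T t0 (\<lambda>_. 1) x"
  have sets_\<nu>: "sets \<nu> = sets \<mu>" using qs fwd.sets_borel by (simp add: quasi_stationary_def)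
  interpret \<nu>: prob_space \<nu> using qs by (simp add: quasi_stationary_def)
  have qs0: "?c > 0" "(LINT x|\<nu>. fwd.T t0 f x) = (LINT x|\<nu>. f x) * ?c" if "f \<in> Linf \<mu>" for f
  proof -
    have *: "?c > 0" "(LINT x|\<nu>. fwd.T t0 f x) / ?c = (LINT x|\<nu>. f x)"
      using qs t0 that unfolding quasi_stationary_def by blast+
    show "?c > 0" by (rule *(1))
    show "(LINT x|\<nu>. fwd.T t0 f x) = (LINT x|\<nu>. f x) * ?c"
      using * by (metis less_irrefl nonzero_divide_eq_eq)
  qed
  have c_pos: "?c > 0" by (rule qs0(1)[OF fwd.Linf_const])
  have ac: "absolutely_continuous \<mu> \<nu>"
    unfolding absolutely_continuous_def
  proof
    fix A assume A: "A \<in> null_sets \<mu>"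
    then have [measurable]: "A \<in> sets \<mu>" by auto
    then have [measurable]: "A \<in> sets \<nu>" by (simp add: sets_\<nu>)
    have iA: "indicator A \<in> Linf \<mu>" by (rule fwd.Linf_indicator) measurable
    have "P t0 (indicator A) = P t0 (\<lambda>_. 0)"
    proof (rule fwd.op_cong_AE[OF t0])
      show "AE x in \<mu>. indicator A x = (0::real)"
        using AE_not_in[OF A] by eventually_elim simp
    qed measurable
    then have "fwd.T t0 (indicator A) = (\<lambda>_. 0)"
      by (intro fwd.T_eqI t0 iA) (auto simp: kernel_op_def)
    then have "0 = (LINT x|\<nu>. indicator A x) * ?c"
      using qs0(2)[OF iA] by simp
    then have "measure \<nu> A = 0" using c_pos by (simp add: Int_absorb2 sets.sets_into_space)
    then show "A \<in> null_sets \<nu>" by (auto simp: \<nu>.emeasure_eq_measure)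
  qed
  obtain \<rho> where \<rho>_meas [measurable]: "\<rho> \<in> borel_measurable \<mu>"
    and RN: "AE x in \<mu>. RN_deriv \<mu> \<nu> x = ennreal (\<rho> x)" and \<rho>0: "\<And>x. 0 \<le> \<rho> x"
    using fwd.real_RN_deriv[OF \<nu>.finite_measure_axioms ac sets_\<nu>] by metis
  have \<nu>_eq: "\<nu> = density \<mu> (\<lambda>x. ennreal (\<rho> x))"
    using fwd.density_RN_deriv[OF ac sets_\<nu>] density_cong[OF _ _ RN] by simp
  have int_\<nu>: "(LINT x|\<nu>. g x) = (LINT x|\<mu>. \<rho> x * g x)" if "g \<in> borel_measurable \<mu>" for g :: "'a \<Rightarrow> real"
    unfolding \<nu>_eq using integral_density[OF that \<rho>_meas] \<rho>0 by simp
  have \<rho>_one: "(LINT x|\<mu>. \<rho> x) = 1"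
    using int_\<nu>[of "\<lambda>_. 1"] \<nu>.prob_space by simp
  have \<rho>_int: "integrable \<mu> \<rho>"
    by (rule ccontr) (use \<rho>_one in \<open>simp add: not_integrable_integral_eq\<close>)
  \<comment> \<open>Testing with the ground state itself identifies the decay rate.\<close>
  have c_eq: "?c = ?e"
  proof -
    have T\<phi>: "fwd.T t0 \<phi> = (\<lambda>x. ?e * \<phi> x)"
      by (intro fwd.T_eqI t0 \<phi>_Linf eigen_\<phi> continuous_intros \<phi>(2))
    obtain b where b: "\<And>x. \<bar>\<phi> x\<bar> \<le> b" using \<phi>(3) by (auto simp: bounded_iff)
    have m\<phi>: "\<phi> \<in> borel_measurable \<nu>" by (simp add: measurable_cong_sets[OF sets_\<nu> refl])
    then have int: "integrable \<nu> \<phi>" by (intro \<nu>.integrable_const_bound[of _ b]) (auto simp: b)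
    have pos: "AE x in \<nu>. 0 < \<phi> x" by (rule absolutely_continuous_AE[OF sets_\<nu> ac \<phi>(4)])
    have "(LINT x|\<nu>. \<phi> x) \<noteq> 0"
    proof
      assume "(LINT x|\<nu>. \<phi> x) = 0"
      then have "AE x in \<nu>. \<phi> x = 0"
        using integral_nonneg_eq_0_iff_AE[OF int] \<phi>_nonneg by simp
      with pos have "AE x in \<nu>. False" by eventually_elim simp
      then show False by simp
    qed
    then show ?thesis using qs0(2)[OF \<phi>_Linf] by (simp add: T\<phi>)
  qed
  have inv: "(LINT x|\<mu>. \<rho> x * f x) = exp (l * t0) * (LINT x|\<mu>. \<rho> x * P t0 f x)" if f: "f \<in> Linf \<mu>" for f
  proof -
    have [measurable]: "f \<in> borel_measurable \<mu>" "fwd.T t0 f \<in> borel_measurable \<mu>" "P t0 f \<in> borel_measurable \<mu>"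
      using f t0 fwd.T_measurable fwd.Linf_measurable fwd.op_measurable by auto
    have "(LINT x|\<mu>. \<rho> x * P t0 f x) = (LINT x|\<mu>. \<rho> x * fwd.T t0 f x)"
    proof (rule integral_cong_AE)
      show "AE x in \<mu>. \<rho> x * P t0 f x = \<rho> x * fwd.T t0 f x"
        using fwd.T_spec(2)[OF t0 f] by eventually_elim simp
    qed auto
    also have "\<dots> = (LINT x|\<mu>. \<rho> x * f x) * ?e"
      using qs0(2)[OF f] by (simp add: int_\<nu> c_eq)
    finally show ?thesis by (simp add: exp_minus)
  qed
  obtain C where C: "\<And>f. sq_integrable \<mu> f \<Longrightarrow> AE x in \<mu>. \<bar>P t0 f x\<bar> \<le> C * sq_norm \<mu> f"
    using smoothing_u by blast
  define C' where "C' = exp (l * t0) * C"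
  have functional: "(LINT x|\<mu>. \<rho> x * f x) \<le> C' * sq_norm \<mu> f"
    if f: "f \<in> Linf \<mu>" "sq_integrable \<mu> f" for f
  proof -
    have le: "AE x in \<mu>. \<bar>P t0 f x\<bar> \<le> C * sq_norm \<mu> f" by (rule C[OF f(2)])
    have [measurable]: "P t0 f \<in> borel_measurable \<mu>"
      using f(1) t0 fwd.Linf_measurable fwd.op_measurable by auto
    have "(LINT x|\<mu>. \<rho> x * P t0 f x) \<le> (LINT x|\<mu>. \<rho> x * (C * sq_norm \<mu> f))"
    proof (rule integral_mono_AE)
      show le': "AE x in \<mu>. \<rho> x * P t0 f x \<le> \<rho> x * (C * sq_norm \<mu> f)"
        using le by eventually_elim (simp add: \<rho>0 mult_left_mono)
      show i: "integrable \<mu> (\<lambda>x. \<rho> x * (C * sq_norm \<mu> f))" using \<rho>_int by simp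
      show "integrable \<mu> (\<lambda>x. \<rho> x * P t0 f x)"
      proof (rule Bochner_Integration.integrable_bound[OF i])
        show "AE x in \<mu>. norm (\<rho> x * P t0 f x) \<le> norm (\<rho> x * (C * sq_norm \<mu> f))"
          using le
        proof eventually_elim
          case (elim x)
          then have "\<bar>P t0 f x\<bar> \<le> \<bar>C * sq_norm \<mu> f\<bar>" by linarith
          then show ?case unfolding real_norm_def abs_mult[of "\<rho> x"] by (intro mult_left_mono) auto
        qed
      qed measurable
    qed
    also have "\<dots> = C * sq_norm \<mu> f" by (simp add: \<rho>_one)
    finally show ?thesis
      unfolding inv[OF f(1)] C'_def mult.assoc by (intro mult_left_mono) auto
  qed
  \<comment> \<open>The functional \<open>f \<mapsto> \<integral> \<rho> f\<close> is bounded in the \<open>L\<^sup>2\<close>-norm, and its value at a truncation of \<open>\<rho>\<close>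
    is the squared norm of that truncation.\<close>
  have \<rho>_sq: "sq_integrable \<mu> \<rho>"
  proof -
    define A where "A n = fwd.E n \<inter> {x. \<rho> x \<le> real n}" for n
    have A_sets [measurable]: "A n \<in> sets \<mu>" for n
    proof -
      have "{x \<in> space \<mu>. \<rho> x \<le> real n} \<in> sets \<mu>" by measurable
      then show ?thesis unfolding A_def using fwd.E_sets by (auto simp: fwd.space_UNIV)
    qed
    let ?f = "\<lambda>n x. \<rho> x * indicator (A n) x"
    have f_eq: "?f n = (\<lambda>x. (\<rho> x * indicator (A n) x) * indicator (fwd.E n) x)" for n
      by (auto simp: A_def split: split_indicator)
    have f_bd: "\<bar>?f n x\<bar> \<le> real n" for n x
      using \<rho>0[of x] by (auto simp: A_def split: split_indicator)
    have f_Linf: "?f n \<in> Linf \<mu>" for n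
      unfolding Linf_def using f_bd by (auto intro!: exI[of _ "real n"])
    have f_sq: "sq_integrable \<mu> (?f n)" for n
      by (subst f_eq) (rule fwd.Linf_cut_sq[OF f_Linf])
    have sq: "(?f n x)\<^sup>2 = (\<rho> x)\<^sup>2 * indicator (A n) x" for n x
      by (simp split: split_indicator)
    have bd: "sq_norm \<mu> (?f n) \<le> \<bar>C'\<bar>" for n
    proof (cases "sq_norm \<mu> (?f n) = 0")
      case False
      then have pos: "sq_norm \<mu> (?f n) > 0" using sq_norm_nonneg[of \<mu> "?f n"] by linarith
      have "sq_norm \<mu> (?f n) * sq_norm \<mu> (?f n) = (LINT x|\<mu>. (?f n x)\<^sup>2)"
        using sq_norm_power2[of \<mu> "?f n"] by (simp add: power2_eq_square)
      also have "\<dots> = (LINT x|\<mu>. \<rho> x * ?f n x)"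
        by (rule Bochner_Integration.integral_cong) (auto simp: power2_eq_square split: split_indicator)
      also have "\<dots> \<le> C' * sq_norm \<mu> (?f n)" by (rule functional[OF f_Linf f_sq])
      finally show ?thesis using pos by (simp add: mult_le_cancel_right)
    qed simp
    have "integrable \<mu> (\<lambda>x. (\<rho> x)\<^sup>2)"
    proof (rule integrable_of_bounded_exhaustion[where A=A and c="C'\<^sup>2"])
      show "incseq A"
      proof (rule incseq_SucI)
        fix n
        have "fwd.E n \<subseteq> fwd.E (Suc n)" using fwd.E_spec by (auto simp: incseq_Suc_iff)
        then show "A n \<subseteq> A (Suc n)" by (auto simp: A_def)
      qed
      show "space \<mu> \<subseteq> (\<Union>n. A n)"
      proof
        fix x
        have "\<forall>\<^sub>F n in sequentially. \<rho> x \<le> real n"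
          using filterlim_real_sequentially by (simp add: filterlim_at_top)
        with fwd.E_eventually[of x] have "\<forall>\<^sub>F n in sequentially. x \<in> A n"
          by eventually_elim (simp add: A_def)
        then have "\<exists>n. x \<in> A n" by (auto simp: eventually_sequentially)
        then show "x \<in> (\<Union>n. A n)" by blast
      qed
      show "integrable \<mu> (\<lambda>x. (\<rho> x)\<^sup>2 * indicator (A n) x)" for n
        using f_sq[of n] unfolding sq_integrable_def sq by simp
      show "(LINT x|\<mu>. (\<rho> x)\<^sup>2 * indicator (A n) x) \<le> C'\<^sup>2" for n
        using power_mono[OF bd[of n] sq_norm_nonneg, of 2] unfolding sq_norm_power2 sq by simp
    qed auto
    then show ?thesis by (simp add: sq_integrable_def)
  qed
  have "AE x in \<mu>. \<rho> x = exp (l * t0) * Q t0 \<rho> x"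
  proof (rule fwd.AE_eq_by_testing[OF \<rho>_sq])
    show "sq_integrable \<mu> (\<lambda>x. exp (l * t0) * Q t0 \<rho> x)"
      by (intro sq_integrable_scale bwd.op_sq t0 \<rho>_sq)
    fix A assume A: "A \<in> sets \<mu>" "emeasure \<mu> A < \<infinity>"
    show "(LINT x|\<mu>. \<rho> x * indicator A x) = (LINT x|\<mu>. exp (l * t0) * Q t0 \<rho> x * indicator A x)"
      using inv[OF fwd.Linf_indicator[OF A(1)]] duality[OF t0 sq_integrable_indicator[OF A] \<rho>_sq]
      by (simp add: mult.commute[of "indicat_real A _"] mult.commute[of "P t0 _ _"] mult.assoc)
  qed
  then have "AE x in \<mu>. Q t0 \<rho> x = ?e * \<rho> x"
    by eventually_elim (simp add: exp_minus)
  then obtain b where b: "AE x in \<mu>. \<rho> x = b * \<psi> x"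
    using \<psi>_simple[OF \<rho>_sq] by blast
  have "(LINT x|\<mu>. \<rho> x) = (LINT x|\<mu>. b * \<psi> x)"
    by (rule integral_cong_AE) (use b in auto)
  then have "b * Z = 1" by (simp add: \<rho>_one Z_def)
  then have "b = 1 / Z" using Z_pos by (simp add: field_simps)
  with b have "AE x in \<mu>. ennreal (\<rho> x) = ennreal (\<psi> x / (LINT y|\<mu>. \<psi> y))"
    by (auto simp: Z_def elim: eventually_mono)
  then show ?thesis
    unfolding \<nu>_eq normalized_measure_def by (intro density_cong) auto
qed

end

section \<open>From complex operators to real kernels\<close>

abbreviation cplx :: "('a \<Rightarrow> real) \<Rightarrow> 'a \<Rightarrow> complex" where
  "cplx f \<equiv> \<lambda>x. complex_of_real (f x)"

lemma L2_cplx: "sq_integrable M f \<Longrightarrow> cplx f \<in> L2 M"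
  by (auto simp: L2_def sq_integrable_def)

lemma l2norm_cplx: "l2norm M (cplx f) = sq_norm M f"
  by (simp add: l2norm_def sq_norm_def)

lemma l2norm_eq_sq_norm:
  assumes [measurable]: "F \<in> borel_measurable M" "f \<in> borel_measurable M"
    and "AE x in M. F x = complex_of_real (f x)"
  shows "l2norm M F = sq_norm M f"
  unfolding l2norm_def sq_norm_def
  by (rule arg_cong[where f=sqrt], rule integral_cong_AE)
    (use assms(3) in \<open>auto elim: eventually_mono\<close>)

lemma has_kernel_cplx:
  assumes "has_kernel M T k" "sq_integrable M f"
  shows "AE x in M. integrable M (\<lambda>y. k x y * f y)"
    and "AE x in M. T (cplx f) x = complex_of_real (kernel_op M k f x)"
proof -
  have "AE x in M. integrable M (\<lambda>y. complex_of_real (k x y) * cplx f y) \<and>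
      T (cplx f) x = (LINT y|M. complex_of_real (k x y) * cplx f y)"
    by (rule bspec[OF conjunct2[OF assms(1)[unfolded has_kernel_def]] L2_cplx[OF assms(2)]])
  then have *: "AE x in M. integrable M (\<lambda>y. k x y * f y) \<and>
      T (cplx f) x = complex_of_real (kernel_op M k f x)"
    unfolding of_real_mult[symmetric] complex_of_real_integrable_eq integral_complex_of_real
    by (simp add: kernel_op_def)
  show "AE x in M. integrable M (\<lambda>y. k x y * f y)"
    "AE x in M. T (cplx f) x = complex_of_real (kernel_op M k f x)"
    using * by (eventually_elim, simp)+
qed

lemma (in sigma_finite_measure) kernel_op_sq_integrable:
  assumes k: "has_kernel M T k" and T: "bounded_l2_operator M T" and f: "sq_integrable M f"
  shows "sq_integrable M (kernel_op M k f)"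
proof -
  have [measurable]: "kernel_op M k f \<in> borel_measurable M"
    using k f by (intro kernel_op_measurable) (auto simp: has_kernel_def sq_integrable_def)
  have "T (cplx f) \<in> L2 M" using T L2_cplx[OF f] by (simp add: bounded_l2_operator_def)
  then have [measurable]: "T (cplx f) \<in> borel_measurable M"
    and i: "integrable M (\<lambda>x. (cmod (T (cplx f) x))\<^sup>2)"
    by (auto simp: L2_def)
  have "integrable M (\<lambda>x. (kernel_op M k f x)\<^sup>2)"
  proof (rule integrable_cong_AE_imp[OF i])
    show "AE x in M. (cmod (T (cplx f) x))\<^sup>2 = (kernel_op M k f x)\<^sup>2"
      using has_kernel_cplx(2)[OF k f] by eventually_elim simp
  qed measurable
  then show ?thesis by (simp add: sq_integrable_def)
qed

lemma has_kernel_cong_AE: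
  assumes k: "has_kernel M T k" and f: "f \<in> L2 M" and g: "g \<in> L2 M" and eq: "AE x in M. f x = g x"
  shows "AE x in M. T f x = T g x"
proof -
  have [measurable]: "case_prod k \<in> borel_measurable (M \<Otimes>\<^sub>M M)"
    "f \<in> borel_measurable M" "g \<in> borel_measurable M"
    using k f g by (auto simp: has_kernel_def L2_def)
  note rep = bspec[OF conjunct2[OF k[unfolded has_kernel_def]]]
  have "AE x in M. T f x = (LINT y|M. complex_of_real (k x y) * f y)"
    using rep[OF f] by eventually_elim simp
  moreover have "AE x in M. T g x = (LINT y|M. complex_of_real (k x y) * g y)"
    using rep[OF g] by eventually_elim simp
  moreover have "AE x in M. x \<in> space M" by simp
  ultimately show ?thesis
  proof eventually_elim
    case (elim x)
    have [measurable]: "k x \<in> borel_measurable M"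
      using measurable_Pair2[of "case_prod k" M M borel x] elim(3) by simp
    have "(LINT y|M. complex_of_real (k x y) * f y) = (LINT y|M. complex_of_real (k x y) * g y)"
      by (rule integral_cong_AE) (use eq in auto)
    with elim show ?case by simp
  qed
qed

lemma l2_adjoint_duality:
  assumes adj: "l2_adjoint M T S" and T: "bounded_l2_operator M T"
    and k: "has_kernel M T k" and k': "has_kernel M S k'"
    and f: "sq_integrable M f" and g: "sq_integrable M g" and "sigma_finite_measure M"
  shows "(LINT x|M. kernel_op M k f x * g x) = (LINT x|M. f x * kernel_op M k' g x)"
proof -
  interpret sigma_finite_measure M by fact
  have S: "bounded_l2_operator M S" using adj by (simp add: l2_adjoint_def)
  have [measurable]: "f \<in> borel_measurable M" "g \<in> borel_measurable M"
    "kernel_op M k f \<in> borel_measurable M" "kernel_op M k' g \<in> borel_measurable M"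
    using f g kernel_op_sq_integrable[OF k T f] kernel_op_sq_integrable[OF k' S g]
    by (auto simp: sq_integrable_def)
  have "T (cplx f) \<in> L2 M" "S (cplx g) \<in> L2 M"
    using T S L2_cplx f g by (auto simp: bounded_l2_operator_def)
  then have [measurable]: "T (cplx f) \<in> borel_measurable M" "S (cplx g) \<in> borel_measurable M"
    by (auto simp: L2_def)
  have [measurable]: "cnj \<in> borel_measurable borel"
    by (intro borel_measurable_continuous_onI continuous_intros)
  have "l2inner M (T (cplx f)) (cplx g) = (LINT x|M. complex_of_real (kernel_op M k f x * g x))"
    unfolding l2inner_def
  proof (rule integral_cong_AE)
    show "AE x in M. T (cplx f) x * cnj (complex_of_real (g x)) = complex_of_real (kernel_op M k f x * g x)"
      using has_kernel_cplx(2)[OF k f] by eventually_elim simp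
  qed simp_all
  moreover have "l2inner M (cplx f) (S (cplx g)) = (LINT x|M. complex_of_real (f x * kernel_op M k' g x))"
    unfolding l2inner_def
  proof (rule integral_cong_AE)
    show "AE x in M. complex_of_real (f x) * cnj (S (cplx g) x) = complex_of_real (f x * kernel_op M k' g x)"
      using has_kernel_cplx(2)[OF k' g] by eventually_elim simp
  qed simp_all
  moreover have "l2inner M (T (cplx f)) (cplx g) = l2inner M (cplx f) (S (cplx g))"
    using adj L2_cplx[OF f] L2_cplx[OF g] by (simp add: l2_adjoint_def)
  ultimately show ?thesis unfolding integral_complex_of_real by simp
qed

lemma ground_state_sq_integrable:
  assumes "ground_state M U l \<phi>" shows "sq_integrable M \<phi>"
proof -
  have "cplx \<phi> \<in> L2 M"
    using assms by (simp add: ground_state_def neg_generator_def generator_def)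
  then have m: "cplx \<phi> \<in> borel_measurable M" and i: "integrable M (\<lambda>x. (\<phi> x)\<^sup>2)"
    by (auto simp: L2_def)
  have "(\<lambda>x. Re (cplx \<phi> x)) \<in> borel_measurable M" using m by measurable
  with i show ?thesis by (simp add: sq_integrable_def)
qed

lemma (in sigma_finite_measure) generator_eigenvector_tendsto:
  assumes g: "neg_generator M U (cplx \<phi>) (\<lambda>x. complex_of_real l * complex_of_real (\<phi> x))"
    and \<phi>: "sq_integrable M \<phi>" and k: "\<And>t. t > 0 \<Longrightarrow> has_kernel M (U t) (u t)"
    and U: "\<And>t. t > 0 \<Longrightarrow> bounded_l2_operator M (U t)"
  shows "((\<lambda>t. sq_norm M (\<lambda>x. (kernel_op M (u t) \<phi> x - \<phi> x) / t + l * \<phi> x)) \<longlongrightarrow> 0) (at_right 0)"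
proof -
  let ?F = "\<lambda>t x. (U t (cplx \<phi>) x - cplx \<phi> x) / complex_of_real t - - (complex_of_real l * cplx \<phi> x)"
  let ?f = "\<lambda>t x. (kernel_op M (u t) \<phi> x - \<phi> x) / t + l * \<phi> x"
  have lim: "((\<lambda>t. l2norm M (?F t)) \<longlongrightarrow> 0) (at_right 0)"
    using g by (simp add: neg_generator_def generator_def)
  have "l2norm M (?F t) = sq_norm M (?f t)" if t: "t > 0" for t
  proof (rule l2norm_eq_sq_norm)
    have [measurable]: "\<phi> \<in> borel_measurable M" "kernel_op M (u t) \<phi> \<in> borel_measurable M"
      using \<phi> kernel_op_sq_integrable[OF k[OF t] U[OF t] \<phi>] by (auto simp: sq_integrable_def)
    have "U t (cplx \<phi>) \<in> L2 M" using U[OF t] L2_cplx[OF \<phi>] by (simp add: bounded_l2_operator_def)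
    then have [measurable]: "U t (cplx \<phi>) \<in> borel_measurable M" by (simp add: L2_def)
    show "?F t \<in> borel_measurable M" "?f t \<in> borel_measurable M" by measurable
    show "AE x in M. ?F t x = complex_of_real (?f t x)"
      using has_kernel_cplx(2)[OF k[OF t] \<phi>] by eventually_elim simp
  qed
  then have "\<forall>\<^sub>F t in at_right 0. l2norm M (?F t) = sq_norm M (?f t)"
    using eventually_at_right_less[of "0::real"] by (auto elim: eventually_mono)
  from Lim_transform_eventually[OF lim this] show ?thesis .
qed

lemma sigma_finite_of_locally_finite:
  fixes \<mu> :: "'a::second_countable_topology measure"
  assumes "sets \<mu> = sets borel" "locally_finite_measure \<mu>"
  shows "sigma_finite_measure \<mu>"
proof
  let ?F = "{V. open V \<and> emeasure \<mu> V < \<infinity>}"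
  obtain F' where F': "F' \<subseteq> ?F" "countable F'" "\<Union>F' = \<Union>?F"
    using Lindelof[of ?F] by blast
  have "\<Union>?F = UNIV" using assms(2) by (auto simp: locally_finite_measure_def)
  with F' have "\<Union>F' = space \<mu>" using sets_eq_imp_space_eq[OF assms(1)] by simp
  moreover have "F' \<subseteq> sets \<mu>" using F'(1) by (auto simp: assms(1))
  moreover have "\<forall>a\<in>F'. emeasure \<mu> a \<noteq> \<infinity>" using F'(1) by auto
  ultimately show "\<exists>A. countable A \<and> A \<subseteq> sets \<mu> \<and> \<Union>A = space \<mu> \<and> (\<forall>a\<in>A. emeasure \<mu> a \<noteq> \<infinity>)"
    using F'(2) by blast
qed

text \<open>Both summands are nonnegative for positive times, so a bound on the sum bounds each of them.\<close>

lemma uniform_bound_of_SUP: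
  fixes a b :: "real \<Rightarrow> 'a \<Rightarrow> real"
  assumes fin: "(SUP t\<in>{t2..}. ereal (exp (l * t)) * (SUP x. ereal (a t x + b t x))) < \<infinity>"
    and nonneg: "\<And>t x. t > 0 \<Longrightarrow> 0 \<le> a t x" "\<And>t x. t > 0 \<Longrightarrow> 0 \<le> b t x" and "t2 > 0"
  shows "\<exists>C T. \<forall>t\<ge>T. \<forall>x. exp (l * t) * a t x \<le> C" "\<exists>C T. \<forall>t\<ge>T. \<forall>x. exp (l * t) * b t x \<le> C"
proof -
  let ?S = "SUP t\<in>{t2..}. ereal (exp (l * t)) * (SUP x. ereal (a t x + b t x))"
  obtain C where C: "?S \<le> ereal C"
    using fin by (cases ?S) auto
  have le: "exp (l * t) * (a t x + b t x) \<le> C" if "t \<ge> t2" for t x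
  proof -
    have "ereal (exp (l * t) * (a t x + b t x)) = ereal (exp (l * t)) * ereal (a t x + b t x)" by simp
    also have "\<dots> \<le> ereal (exp (l * t)) * (SUP x. ereal (a t x + b t x))"
      by (intro ereal_mult_left_mono SUP_upper) auto
    also have "\<dots> \<le> ?S" by (rule SUP_upper) (use that in simp)
    also note C
    finally show ?thesis by simp
  qed
  have "exp (l * t) * a t x \<le> C \<and> exp (l * t) * b t x \<le> C" if t: "t \<ge> t2" for t x
  proof -
    have "0 \<le> exp (l * t) * a t x" "0 \<le> exp (l * t) * b t x"
      using nonneg[of t x] t \<open>t2 > 0\<close> by auto
    with le[OF t, of x] show ?thesis by (simp add: distrib_left)
  qed
  then show "\<exists>C T. \<forall>t\<ge>T. \<forall>x. exp (l * t) * a t x \<le> C" "\<exists>C T. \<forall>t\<ge>T. \<forall>x. exp (l * t) * b t x \<le> C"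
    by blast+
qed

text \<open>The hypotheses on the complex \<open>L\<^sup>2\<close>-semigroup, read on real functions, are those of the abstract
  setting. The adjoint semigroup gets its positivity, its semigroup law and its bound for small
  times from \<open>U\<close> by duality.\<close>

lemma ground_state_pair_of_semigroup:
  fixes \<mu> :: "'a::polish_space measure"
    and U Us :: "real \<Rightarrow> ('a \<Rightarrow> complex) \<Rightarrow> 'a \<Rightarrow> complex"
  assumes sets: "sets \<mu> = sets borel"
    and lf: "locally_finite_measure \<mu>"
    and supp: "full_support \<mu>"
    and sg: "strongly_continuous_semigroup \<mu> U"
    and pos: "\<forall>t\<ge>0. positivity_preserving \<mu> (U t)"
    and adj: "\<forall>t\<ge>0. l2_adjoint \<mu> (U t) (Us t)"
    and ku: "\<forall>t>0. has_kernel \<mu> (U t) (u t)"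
    and kv: "\<forall>t>0. has_kernel \<mu> (Us t) (v t)"
    and t0: "t0 > 0"
    and imp: "positivity_improving \<mu> (U t0)"
    and Fu: "strong_Feller \<mu> u" and Fv: "strong_Feller \<mu> v"
    and Su: "bounded_L2_to_Linf \<mu> (U t0)" and Sv: "bounded_L2_to_Linf \<mu> (Us t0)"
    and \<phi>: "ground_state \<mu> U l \<phi>" and \<psi>: "ground_state \<mu> Us l \<psi>"
    and Gu: "pGSD \<mu> u l \<phi>" and Gv: "pGSD \<mu> v l \<psi>"
    and mass: "\<exists>t2>0. (SUP t\<in>{t2..}. ereal (exp (l * t)) *
           (SUP x. ereal (Feller_op \<mu> u t (\<lambda>_. 1) x + Feller_op \<mu> v t (\<lambda>_. 1) x))) < \<infinity>"
  shows "ground_state_pair \<mu> u v \<phi> \<psi> l t0"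
proof -
  interpret sigma_finite_measure \<mu> by (rule sigma_finite_of_locally_finite[OF sets lf])
  have bU: "bounded_l2_operator \<mu> (U t)" if "t > 0" for t
    using sg that by (simp add: strongly_continuous_semigroup_def)
  have bV: "bounded_l2_operator \<mu> (Us t)" if "t > 0" for t
    using adj that by (simp add: l2_adjoint_def)
  have kU: "has_kernel \<mu> (U t) (u t)" and kV: "has_kernel \<mu> (Us t) (v t)" if "t > 0" for t
    using ku kv that by auto
  have L2U: "U t F \<in> L2 \<mu>" if "t > 0" "F \<in> L2 \<mu>" for t F
    using bU[OF that(1)] that(2) by (simp add: bounded_l2_operator_def)
  have dual: "(LINT x|\<mu>. kernel_op \<mu> (u t) f x * g x) = (LINT x|\<mu>. f x * kernel_op \<mu> (v t) g x)"
    if "t > 0" "sq_integrable \<mu> f" "sq_integrable \<mu> g" for t f g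
    using adj that by (intro l2_adjoint_duality[OF _ bU kU kV] sigma_finite_measure_axioms) auto
  interpret fwd: positive_kernel \<mu> u
  proof unfold_locales
    fix t :: real assume t: "t > 0"
    show "case_prod (u t) \<in> borel_measurable (\<mu> \<Otimes>\<^sub>M \<mu>)"
      using kU[OF t] by (simp add: has_kernel_def)
    fix f assume f: "sq_integrable \<mu> f"
    show "AE x in \<mu>. integrable \<mu> (\<lambda>y. u t x y * f y)" by (rule has_kernel_cplx(1)[OF kU[OF t] f])
    show "sq_integrable \<mu> (kernel_op \<mu> (u t) f)" by (rule kernel_op_sq_integrable[OF kU[OF t] bU[OF t] f])
    show "AE x in \<mu>. 0 \<le> kernel_op \<mu> (u t) f x" if "AE x in \<mu>. 0 \<le> f x"
    proof -
      have "AE x in \<mu>. cplx f x \<in> \<real>\<^sub>\<ge>\<^sub>0" using that by eventually_elim simp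
      then have "AE x in \<mu>. U t (cplx f) x \<in> \<real>\<^sub>\<ge>\<^sub>0"
        using pos t L2_cplx[OF f] by (simp add: positivity_preserving_def)
      with has_kernel_cplx(2)[OF kU[OF t] f] show ?thesis by eventually_elim simp
    qed
  next
    fix s t :: real and f assume s: "s > 0" and t: "t > 0" and f: "sq_integrable \<mu> f"
    have st: "s + t > 0" using s t by simp
    have Pf: "sq_integrable \<mu> (kernel_op \<mu> (u t) f)"
      by (rule kernel_op_sq_integrable[OF kU[OF t] bU[OF t] f])
    have "AE x in \<mu>. U (s + t) (cplx f) x = U s (U t (cplx f)) x"
      using sg s t L2_cplx[OF f] by (simp add: strongly_continuous_semigroup_def)
    moreover have "AE x in \<mu>. U s (U t (cplx f)) x = U s (cplx (kernel_op \<mu> (u t) f)) x"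
      by (rule has_kernel_cong_AE[OF kU[OF s] L2U[OF t L2_cplx[OF f]] L2_cplx[OF Pf]
            has_kernel_cplx(2)[OF kU[OF t] f]])
    moreover note has_kernel_cplx(2)[OF kU[OF s] Pf] has_kernel_cplx(2)[OF kU[OF st] f]
    ultimately show "AE x in \<mu>. kernel_op \<mu> (u (s + t)) f x = kernel_op \<mu> (u s) (kernel_op \<mu> (u t) f) x"
      by eventually_elim simp
  qed (fact sets supp Fu)+
  have "positive_kernel \<mu> v"
  proof (rule fwd.positive_kernel_dual)
    show "case_prod (v t) \<in> borel_measurable (\<mu> \<Otimes>\<^sub>M \<mu>)" if "t > 0" for t
      using kV[OF that] by (simp add: has_kernel_def)
    show "AE x in \<mu>. integrable \<mu> (\<lambda>y. v t x y * f y)" if "t > 0" "sq_integrable \<mu> f" for t f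
      by (rule has_kernel_cplx(1)[OF kV[OF that(1)] that(2)])
    show "sq_integrable \<mu> (kernel_op \<mu> (v t) f)" if "t > 0" "sq_integrable \<mu> f" for t f
      by (rule kernel_op_sq_integrable[OF kV[OF that(1)] bV[OF that(1)] that(2)])
  qed (fact dual Fv)+
  then interpret dual_kernels \<mu> u v
    by (intro dual_kernels.intro dual_kernels_axioms.intro fwd.positive_kernel_axioms dual)
  have sc: "((\<lambda>t. sq_norm \<mu> (\<lambda>x. P t f x - f x)) \<longlongrightarrow> 0) (at_right 0)" if f: "sq_integrable \<mu> f" for f
  proof -
    have lim: "((\<lambda>t. l2norm \<mu> (\<lambda>x. U t (cplx f) x - cplx f x)) \<longlongrightarrow> 0) (at_right 0)"
      using sg L2_cplx[OF f] unfolding strongly_continuous_semigroup_def by blast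
    have "l2norm \<mu> (\<lambda>x. U t (cplx f) x - cplx f x) = sq_norm \<mu> (\<lambda>x. P t f x - f x)" if t: "t > 0" for t
    proof (rule l2norm_eq_sq_norm)
      have [measurable]: "f \<in> borel_measurable \<mu>" "P t f \<in> borel_measurable \<mu>"
        using f fwd.op_sq[OF t f] by (auto simp: sq_integrable_def)
      have [measurable]: "U t (cplx f) \<in> borel_measurable \<mu>"
        using L2U[OF t L2_cplx[OF f]] by (simp add: L2_def)
      show "(\<lambda>x. U t (cplx f) x - cplx f x) \<in> borel_measurable \<mu>"
        "(\<lambda>x. P t f x - f x) \<in> borel_measurable \<mu>" by measurable
      show "AE x in \<mu>. U t (cplx f) x - cplx f x = complex_of_real (P t f x - f x)"
        using has_kernel_cplx(2)[OF kU[OF t] f] by eventually_elim simp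
    qed
    then have "\<forall>\<^sub>F t in at_right 0. l2norm \<mu> (\<lambda>x. U t (cplx f) x - cplx f x) = sq_norm \<mu> (\<lambda>x. P t f x - f x)"
      using eventually_at_right_less[of "0::real"] by (auto elim: eventually_mono)
    from Lim_transform_eventually[OF lim this] show ?thesis .
  qed
  obtain B d where Bd: "B > 0" "d > 0" and bound_u: "\<And>t f. 0 < t \<Longrightarrow> t \<le> d \<Longrightarrow> sq_integrable \<mu> f \<Longrightarrow>
      sq_norm \<mu> (P t f) \<le> B * sq_norm \<mu> f"
    using fwd.small_time_bound[OF sc] by blast
  have bound_v: "sq_norm \<mu> (Q t f) \<le> B * sq_norm \<mu> f" if "0 < t" "t \<le> d" "sq_integrable \<mu> f" for t f
    by (rule dual_norm_bound[OF that(1) bound_u[OF that(1,2)] that(3)])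
  have \<phi>_sq: "sq_integrable \<mu> \<phi>" and \<psi>_sq: "sq_integrable \<mu> \<psi>"
    using \<phi> \<psi> by (auto intro: ground_state_sq_integrable)
  have gen_\<phi>: "neg_generator \<mu> U (cplx \<phi>) (\<lambda>x. complex_of_real l * complex_of_real (\<phi> x))"
    and gen_\<psi>: "neg_generator \<mu> Us (cplx \<psi>) (\<lambda>x. complex_of_real l * complex_of_real (\<psi> x))"
    using \<phi> \<psi> by (simp_all add: ground_state_def)
  obtain t2 where t2: "t2 > 0" "(SUP t\<in>{t2..}. ereal (exp (l * t)) *
      (SUP x. ereal (fwd.T t (\<lambda>_. 1) x + bwd.T t (\<lambda>_. 1) x))) < \<infinity>"
    using mass by blast
  have masses: "\<exists>C T. \<forall>t\<ge>T. \<forall>x. exp (l * t) * fwd.T t (\<lambda>_. 1) x \<le> C"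
      "\<exists>C T. \<forall>t\<ge>T. \<forall>x. exp (l * t) * bwd.T t (\<lambda>_. 1) x \<le> C"
    by (rule uniform_bound_of_SUP[OF t2(2) _ _ t2(1)]; rule fwd.T_one_nonneg bwd.T_one_nonneg, assumption)+
  have smooth: "\<exists>C. \<forall>f. sq_integrable \<mu> f \<longrightarrow> (AE x in \<mu>. \<bar>kernel_op \<mu> k f x\<bar> \<le> C * sq_norm \<mu> f)"
    if T: "bounded_L2_to_Linf \<mu> T" "has_kernel \<mu> T k" for T k
  proof -
    obtain C where C: "\<And>F. F \<in> L2 \<mu> \<Longrightarrow> AE x in \<mu>. cmod (T F x) \<le> C * l2norm \<mu> F"
      using T(1) unfolding bounded_L2_to_Linf_def by blast
    have "AE x in \<mu>. \<bar>kernel_op \<mu> k f x\<bar> \<le> C * sq_norm \<mu> f" if f: "sq_integrable \<mu> f" for f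
      using C[OF L2_cplx[OF f]] has_kernel_cplx(2)[OF T(2) f]
      by eventually_elim (simp add: l2norm_cplx)
    then show ?thesis by blast
  qed
  show ?thesis
  proof unfold_locales
    fix f g assume f: "sq_integrable \<mu> f" and g: "sq_integrable \<mu> g"
      and f0: "AE x in \<mu>. 0 \<le> f x" and g0: "AE x in \<mu>. 0 \<le> g x"
      and fn: "\<not> (AE x in \<mu>. f x = 0)" and gn: "\<not> (AE x in \<mu>. g x = 0)"
    have "AE x in \<mu>. cplx f x \<in> \<real>\<^sub>\<ge>\<^sub>0" using f0 by eventually_elim simp
    moreover have "\<not> (AE x in \<mu>. cplx f x = 0)" using fn by simp
    ultimately have "AE x in \<mu>. U t0 (cplx f) x \<in> \<real>\<^sub>\<ge>\<^sub>0 - {0}"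
      using bspec[OF imp[unfolded positivity_improving_def] L2_cplx[OF f]] by simp
    with has_kernel_cplx(2)[OF kU[OF t0] f] have Pf: "AE x in \<mu>. 0 < P t0 f x"
      by eventually_elim (auto simp: less_le)
    have int: "integrable \<mu> (\<lambda>x. P t0 f x * g x)"
      by (rule sq_integrable_mult[OF fwd.op_sq[OF t0 f] g])
    have nn: "AE x in \<mu>. 0 \<le> P t0 f x * g x" using Pf g0 by eventually_elim simp
    have "(LINT x|\<mu>. P t0 f x * g x) \<noteq> 0"
    proof
      assume "(LINT x|\<mu>. P t0 f x * g x) = 0"
      then have "AE x in \<mu>. P t0 f x * g x = 0"
        using integral_nonneg_eq_0_iff_AE[OF int nn] by simp
      with Pf have "AE x in \<mu>. g x = 0" by eventually_elim simp
      with gn show False by simp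
    qed
    with integral_nonneg_AE[OF nn] show "0 < (LINT x|\<mu>. P t0 f x * g x)" by simp
  next
    fix t :: real assume t: "t > 0"
    show "AE x in \<mu>. P t \<phi> x = exp (- l * t) * \<phi> x"
      by (rule fwd.eigenvector_of_generator[OF Bd bound_u \<phi>_sq generator_eigenvector_tendsto[OF gen_\<phi> \<phi>_sq kU bU] t])
    show "AE x in \<mu>. Q t \<psi> x = exp (- l * t) * \<psi> x"
      by (rule bwd.eigenvector_of_generator[OF Bd bound_v \<psi>_sq generator_eigenvector_tendsto[OF gen_\<psi> \<psi>_sq kV bV] t])
  next
    show "continuous_on UNIV \<phi>" "bounded (range \<phi>)" "AE x in \<mu>. 0 < \<phi> x"
      "continuous_on UNIV \<psi>" "bounded (range \<psi>)" "AE x in \<mu>. 0 < \<psi> x"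
      using \<phi> \<psi> by (simp_all add: ground_state_def)
  qed (fact t0 smooth[OF Su kU[OF t0]] smooth[OF Sv kV[OF t0]] \<phi>_sq \<psi>_sq Gu Gv masses)+
qed

section \<open>Quasi-stationary measures of the semigroup\<close>

theorem theorem5p5:
  fixes \<mu> :: "'a::polish_space measure"
    and U Us :: "real \<Rightarrow> ('a \<Rightarrow> complex) \<Rightarrow> 'a \<Rightarrow> complex"
    and u :: "real \<Rightarrow> 'a \<Rightarrow> 'a \<Rightarrow> real"
    and t0 lam0 :: real
    and \<phi>0 \<psi>0 :: "'a \<Rightarrow> real"
  assumes "locally_compact_space (euclidean :: 'a topology)"
    and "\<not> compact (UNIV :: 'a set)"
    and "sets \<mu> = sets borel"
    and "locally_finite_measure \<mu>"
    and "full_support \<mu>"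
    and "strongly_continuous_semigroup \<mu> U"
    and "\<forall>t\<ge>0. positivity_preserving \<mu> (U t)"
    and "\<forall>t\<ge>0. l2_adjoint \<mu> (U t) (Us t)"
    and "\<forall>t>0. has_kernel \<mu> (U t) (u t)"
    and "\<forall>t>0. has_kernel \<mu> (Us t) (transpose_kernel u t)"
    and "t0 > 0"
    and "\<forall>t>0. compact_l2_operator \<mu> (U t)"
    and "positivity_improving \<mu> (U t0)"
    and "strong_Feller \<mu> u"
    and "strong_Feller \<mu> (transpose_kernel u)"
    and "bounded_L2_to_Linf \<mu> (U t0)"
    and "bounded_L2_to_Linf \<mu> (Us t0)"
    and "\<forall>t\<ge>t0. \<forall>\<epsilon>>0. \<exists>K. compact K \<and> (\<forall>x. x \<notin> K \<longrightarrow>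
           Feller_op \<mu> u t (\<lambda>_. 1) x \<le> \<epsilon> \<and> Feller_op \<mu> (transpose_kernel u) t (\<lambda>_. 1) x \<le> \<epsilon>)"
    and "lam0 = spectral_bottom \<mu> U"
    and "ground_state \<mu> U lam0 \<phi>0"
    and "ground_state \<mu> Us lam0 \<psi>0"
    and "pGSD \<mu> u lam0 \<phi>0"
    and "pGSD \<mu> (transpose_kernel u) lam0 \<psi>0"
    and "\<exists>t2>0. (SUP t\<in>{t2..}. ereal (exp (lam0 * t)) *
           (SUP x. ereal (Feller_op \<mu> u t (\<lambda>_. 1) x
                        + Feller_op \<mu> (transpose_kernel u) t (\<lambda>_. 1) x))) < \<infinity>"
  defines "N \<equiv> {x. \<phi>0 x = 0} \<union> {x. \<psi>0 x = 0}"
    and "m \<equiv> normalized_measure \<mu> \<psi>0"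
    and "ms \<equiv> normalized_measure \<mu> \<phi>0"
  shows "(quasi_stationary \<mu> u m \<and> quasi_stationary \<mu> (transpose_kernel u) ms \<and>
          measure m (UNIV - N) * measure ms (UNIV - N) > 0) \<and>
         (\<forall>\<nu> \<nu>s. quasi_stationary \<mu> u \<nu> \<and> quasi_stationary \<mu> (transpose_kernel u) \<nu>s \<and>
            measure \<nu> (UNIV - N) * measure \<nu>s (UNIV - N) > 0 \<longrightarrow> \<nu> = m \<and> \<nu>s = ms)"
proof -
  have pair: "ground_state_pair \<mu> u (transpose_kernel u) \<phi>0 \<psi>0 lam0 t0"
    by (rule ground_state_pair_of_semigroup) (fact assms)+
  interpret fw: ground_state_pair \<mu> u "transpose_kernel u" \<phi>0 \<psi>0 lam0 t0 by (rule pair)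
  interpret bw: ground_state_pair \<mu> "transpose_kernel u" u \<psi>0 \<phi>0 lam0 t0 by (rule fw.swap)
  have "closed N"
    unfolding N_def by (intro closed_Un closed_Collect_eq fw.\<phi>(2) fw.\<psi>(2) continuous_on_const)
  then have N: "UNIV - N \<in> sets \<mu>" by (simp add: assms(3) borel_closed)
  have off_N: "AE x in \<mu>. x \<in> UNIV - N"
    using fw.\<phi>(4) fw.\<psi>(4) by eventually_elim (simp add: N_def)
  have "measure m (UNIV - N) = 1"
    unfolding m_def using prob_space.prob_eq_1[OF fw.prob_space_m, of "UNIV - N"] N fw.AE_m[OF off_N]
    by (simp add: fw.sets_m)
  moreover have "measure ms (UNIV - N) = 1"
    unfolding ms_def using prob_space.prob_eq_1[OF bw.prob_space_m, of "UNIV - N"] N bw.AE_m[OF off_N]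
    by (simp add: bw.sets_m)
  ultimately have "measure m (UNIV - N) * measure ms (UNIV - N) > 0" by simp
  moreover have "quasi_stationary \<mu> u m" "quasi_stationary \<mu> (transpose_kernel u) ms"
    unfolding m_def ms_def by (rule fw.quasi_stationary_m, rule bw.quasi_stationary_m)
  moreover have "\<nu> = m" if "quasi_stationary \<mu> u \<nu>" for \<nu>
    unfolding m_def by (rule fw.quasi_stationary_unique[OF that])
  moreover have "\<nu>s = ms" if "quasi_stationary \<mu> (transpose_kernel u) \<nu>s" for \<nu>s
    unfolding ms_def by (rule bw.quasi_stationary_unique[OF that])
  ultimately show ?thesis by blast
qed

end
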